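(* Assume that $\mu=(\mu_{ij})_{i,j=1}^\infty$ is a symmetric non-negative matrix with $\mu_{ii}=0$ for all $i$ and $0<\|\mu\|:=\sum_{i<j}\mu_{ij}<\infty$. Let $G_m$ ($m\ge1$) and $\tilde G_t$ ($t\ge0$) be the random simple graphs constructed from $\mu$, let $\mu_i:=\sum_j\mu_{ij}$, and let $v(t):=\mathbb E\,v(\tilde G_t)$ and $e(t):=\mathbb E\,e(\tilde G_t)$. (i) As $t\to\infty$, almost surely $v(\tilde G_t)/v(t)\to1$ and $e(\tilde G_t)/e(t)\to1$. Moreover, if $\mu_{ij}>0$ for infinitely many pairs $(i,j)$, then as $t\to\infty$, $v(t)\to\infty$, $e(t)\to\infty$, and almost surely $v(\tilde G_t)\to\infty$ and $e(\tilde G_t)\to\infty$. (ii) As $m\to\infty$, almost surely $$\frac{v(G_m)}{v(\|\mu\|^{-1}m)}\to1,\qquad \frac{e(G_m)}{e(\|\mu\|^{-1}m)}\to1.$$ In particular, almost surely (as $m\to\infty$) $$v(G_m)\asymp\sum_{i=1}^\infty\min\{1,\mu_i m\},\qquad e(G_m)\asymp\sum_{i,j}\min\{1,\mu_{ij}m\}.$$ Consequently, if $\mu_{ij}>0$ for infinitely many pairs $(i,j)$, then almost surely $v(G_m)\to\infty$ and $e(G_m)\to\infty$ as $m\to\infty$.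
   Context: $v(G)$ and $e(G)$ denote the numbers of vertices and edges of a graph $G$. $f(x)\asymp g(x)$ as $x\to\infty$ means that there exist constants $c,C>0$ and $x_0$ with $c\,g(x)\le f(x)\le C\,g(x)$ for $x\ge x_0$. Construction of $G_m$: let $Y_1,Y_2,\dots$ be i.i.d. random two-element subsets of $\mathbb N=\{1,2,\dots\}$ with $\mathbb P(Y_k=\{i,j\})=\mu_{ij}/\|\mu\|$ for $i<j$; $G_m$ is the simple graph with edge set $\{Y_k:1\le k\le m\}$ (repeated edges merged) and vertex set $\bigcup_{k\le m}Y_k$. All $G_m$ are built from the same sequence. Construction of $\tilde G_t$ (Poisson version): copies of each edge $ij$, $i<j$, arrive according to a Poisson process on $[0,\infty)$ with rate $\mu_{ij}$, independently for different pairs; $\tilde G_t$ is the simple graph whose edges are the pairs $ij$ that have arrived at least once in $[0,t]$, and whose vertex set is the set of endpoints of these edges. Thus $v(t)=\sum_{i\ge1}(1-e^{-\mu_it})$ and $e(t)=\sum_{i<j}(1-e^{-\mu_{ij}t})$. *)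

theory Defs
  imports "HOL-Probability.Probability"
begin

text \<open>
  A simple graph is a pair of a vertex set and a set of two-element sets of vertices. The labels
  range over the positive naturals, and the quantities below only look at \<open>\<mu> i j\<close> with
  \<open>i, j \<ge> 1\<close>.
\<close>

type_synonym graph = "nat set \<times> nat set set"

definition num_vertices :: "graph \<Rightarrow> nat" where
  "num_vertices G = card (fst G)"

definition num_edges :: "graph \<Rightarrow> nat" where
  "num_edges G = card (snd G)"

definition graph_of_edges :: "nat set set \<Rightarrow> graph" where
  "graph_of_edges E = (\<Union>E, E)"

definition index_pairs :: "(nat \<times> nat) set" where
  "index_pairs = {(i, j). 1 \<le> i \<and> i < j}"

definition all_edges :: "nat set set" where
  "all_edges = (\<lambda>(i, j). {i, j}) ` index_pairs"

definition total_mass :: "(nat \<Rightarrow> nat \<Rightarrow> real) \<Rightarrow> real" where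
  "total_mass \<mu> = (\<Sum>\<^sub>\<infinity>(i, j)\<in>index_pairs. \<mu> i j)"

definition vertex_rate :: "(nat \<Rightarrow> nat \<Rightarrow> real) \<Rightarrow> nat \<Rightarrow> real" where
  "vertex_rate \<mu> i = (\<Sum>\<^sub>\<infinity>j\<in>{1..}. \<mu> i j)"

text \<open>Summability is stated separately because \<open>infsum\<close> is \<open>0\<close> on a non-summable family.\<close>

definition edge_weights :: "(nat \<Rightarrow> nat \<Rightarrow> real) \<Rightarrow> bool" where
  "edge_weights \<mu> \<longleftrightarrow>
     (\<forall>i\<ge>1. \<forall>j\<ge>1. \<mu> i j = \<mu> j i \<and> 0 \<le> \<mu> i j) \<and>
     (\<forall>i\<ge>1. \<mu> i i = 0) \<and>
     (\<lambda>(i, j). \<mu> i j) summable_on index_pairs \<and>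
     0 < total_mass \<mu>"

definition (in prob_space) iid_edges ::
    "(nat \<Rightarrow> nat \<Rightarrow> real) \<Rightarrow> (nat \<Rightarrow> 'a \<Rightarrow> nat set) \<Rightarrow> bool" where
  "iid_edges \<mu> Y \<longleftrightarrow>
     indep_vars (\<lambda>_. count_space all_edges) Y {1..} \<and>
     (\<forall>k\<ge>1. \<forall>(i, j)\<in>index_pairs.
        prob {\<omega> \<in> space M. Y k \<omega> = {i, j}} = \<mu> i j / total_mass \<mu>)"

definition edge_graph :: "(nat \<Rightarrow> 'a \<Rightarrow> nat set) \<Rightarrow> nat \<Rightarrow> 'a \<Rightarrow> graph" where
  "edge_graph Y m \<omega> = graph_of_edges ((\<lambda>k. Y k \<omega>) ` {1..m})"

text \<open>
  A Poisson process on \<open>[0, \<infinity>)\<close> with rate \<open>r \<ge> 0\<close> is given by its counting process: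
  \<open>N t\<close> is the number of arrivals in \<open>[0, t]\<close>. Since the paths are almost surely nondecreasing,
  the truncated subtraction on \<open>nat\<close> almost surely is the true increment. The rate \<open>0\<close> is
  allowed (\<open>0 ^ 0 = 1\<close>, so all increments are then almost surely \<open>0\<close>), which is why
  \<open>poisson_pmf\<close>, specified only for positive rates, is not used.
\<close>

definition (in prob_space) poisson_process ::
    "real \<Rightarrow> (real \<Rightarrow> 'a \<Rightarrow> nat) \<Rightarrow> bool" where
  "poisson_process r N \<longleftrightarrow>
     (\<forall>t\<ge>0. random_variable (count_space UNIV) (N t)) \<and>
     (AE \<omega> in M. N 0 \<omega> = 0 \<and> mono_on {0..} (\<lambda>t. N t \<omega>) \<and>
        (\<forall>t\<ge>0. continuous (at_right t) (\<lambda>s. real (N s \<omega>)))) \<and>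
     (\<forall>s t k. 0 \<le> s \<and> s < t \<longrightarrow>
        prob {\<omega> \<in> space M. N t \<omega> - N s \<omega> = k} =
          (r * (t - s)) ^ k / fact k * exp (- (r * (t - s)))) \<and>
     (\<forall>n \<tau>. 0 \<le> \<tau> 0 \<and> mono_on {..n} \<tau> \<longrightarrow>
        indep_vars (\<lambda>_. count_space UNIV)
          (\<lambda>k \<omega>. N (\<tau> (Suc k)) \<omega> - N (\<tau> k) \<omega>) {..<n})"

text \<open>Independence across pairs is independence of whole sample paths.\<close>

definition (in prob_space) poisson_arrivals ::
    "(nat \<Rightarrow> nat \<Rightarrow> real) \<Rightarrow> (nat \<Rightarrow> nat \<Rightarrow> real \<Rightarrow> 'a \<Rightarrow> nat) \<Rightarrow> bool" where
  "poisson_arrivals \<mu> N \<longleftrightarrow>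
     (\<forall>(i, j)\<in>index_pairs. poisson_process (\<mu> i j) (N i j)) \<and>
     indep_vars (\<lambda>_. PiM {0..} (\<lambda>_. count_space UNIV))
       (\<lambda>(i, j) \<omega>. \<lambda>t\<in>{0..}. N i j t \<omega>) index_pairs"

text \<open>
  With summable rates the set of edges that have arrived by time \<open>t\<close> is almost surely finite
  for all \<open>t\<close>; on the exceptional null set \<open>card\<close> may return the junk value \<open>0\<close>.
\<close>

definition poisson_graph :: "(nat \<Rightarrow> nat \<Rightarrow> real \<Rightarrow> 'a \<Rightarrow> nat) \<Rightarrow> real \<Rightarrow> 'a \<Rightarrow> graph" where
  "poisson_graph N t \<omega> =
     graph_of_edges {{i, j} | i j. (i, j) \<in> index_pairs \<and> N i j t \<omega> \<ge> 1}"

definition (in prob_space) mean_vertices ::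
    "(nat \<Rightarrow> nat \<Rightarrow> real \<Rightarrow> 'a \<Rightarrow> nat) \<Rightarrow> real \<Rightarrow> real" where
  "mean_vertices N t = expectation (\<lambda>\<omega>. real (num_vertices (poisson_graph N t \<omega>)))"

definition (in prob_space) mean_edges ::
    "(nat \<Rightarrow> nat \<Rightarrow> real \<Rightarrow> 'a \<Rightarrow> nat) \<Rightarrow> real \<Rightarrow> real" where
  "mean_edges N t = expectation (\<lambda>\<omega>. real (num_edges (poisson_graph N t \<omega>)))"

definition same_order :: "(nat \<Rightarrow> real) \<Rightarrow> (nat \<Rightarrow> real) \<Rightarrow> bool" where
  "same_order f g \<longleftrightarrow>
     (\<exists>c>0. \<exists>C>0. \<exists>x\<^sub>0. \<forall>x\<ge>x\<^sub>0. c * g x \<le> f x \<and> f x \<le> C * g x)"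

end

theory Submission
  imports Defs "HOL-Real_Asymp.Real_Asymp"
begin

text \<open>
  Let \<open>X\<close> be the number of vertices, or of edges, of the random graph at a given time. The theorem
  is a law of large numbers for \<open>X\<close>: a variance of the order of the mean and a deterministic
  normalisation that grows by at most a constant per unit of time. Both are obtained from one feature
  that the two models share. For a set \<open>S\<close> of edges of total weight \<open>x\<close>, the probability that no
  edge of \<open>S\<close> is present at the integer time \<open>n\<close> is \<open>(g x)\<^sup>n\<close>, where \<open>g x = exp (- x)\<close> for the Poisson
  arrivals and \<open>g x = 1 - x\<close> for the i.i.d. draws (with weights normalised to total \<open>1\<close>). The locale
  \<open>growing_edge_set\<close> collects this and a few inequalities for \<open>g\<close>, and the models only have to
  instantiate it (lemma \<open>iid_growing_edge_set\<close>, locale \<open>poisson_edges\<close>).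

  Variance. Presences of distinct edges are non-positively correlated. Presences of two vertices
  \<open>i\<close> and \<open>j\<close> are positively correlated because of the possible edge \<open>{i, j}\<close>, but their covariance is
  at most the probability that \<open>{i, j}\<close> is present and isolated. For fixed \<open>i\<close> these events are
  disjoint as \<open>j\<close> varies, and they imply that \<open>i\<close> is present, so the covariances with \<open>i\<close> add up to at
  most the probability that \<open>i\<close> is present. In all cases the variance is therefore at most twice
  the mean \<open>b\<close> (lemma \<open>second_moment_card_occurring\<close>).

  Mean. With \<open>r i\<close> the rate of the vertex or edge \<open>i\<close>, the normalisation is
  \<open>a t = (\<Sum>i. 1 - exp (- r i * t))\<close>. It is the mean in the Poisson model. In the i.i.d. model each
  summand differs from the probability of presence by at most \<open>r i\<close>, uniformly in time (lemma
  \<open>power_exp_gap\<close>), so the means differ by at most the constant \<open>\<Sum>i. r i\<close>. The same constant bounds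
  the increments of \<open>a\<close> over unit time.

  Almost sure convergence. If infinitely many rates are positive, then \<open>a\<close> tends to infinity, and
  along times \<open>s k\<close> with \<open>a (s k)\<close> close to \<open>k\<^sup>2\<close> the second moments of \<open>(X - a) / a\<close> are summable.
  Hence \<open>X / a\<close> tends to \<open>1\<close> along these times. Both \<open>X\<close> and \<open>a\<close> increase in time, and
  \<open>a (s (k + 1)) / a (s k)\<close> tends to \<open>1\<close>, so monotonicity fills the gaps (lemma
  \<open>ratio_tendsto_1_of_subsequence\<close>). If only finitely many rates are positive, \<open>X\<close> is eventually
  their number, which is also the limit of \<open>a\<close>. A second use of monotonicity carries the Poisson
  result from integer to real times.

  The orders of magnitude follow from
  \<open>min 1 x / 2 \<le> 1 - exp (- x) \<le> min 1 x\<close>, summed over the rates.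
\<close>

section \<open>Ratios of monotone functions along subsequences\<close>

text \<open>
  Between \<open>s k\<close> and \<open>s (k + 1)\<close> monotonicity squeezes \<open>f t / a t\<close> between
  \<open>f (s k) / a (s (k + 1))\<close> and \<open>f (s (k + 1)) / a (s k)\<close>, and both bounds differ from the ratios at
  the times \<open>s\<close> by factors that tend to \<open>1\<close>. The index type is left general because the lemma is used
  for natural and for real time.
\<close>
lemma ratio_tendsto_1_of_subsequence:
  fixes f a :: "'t::linorder \<Rightarrow> real" and s :: "nat \<Rightarrow> 't"
  assumes "mono s" and s_top: "filterlim s at_top sequentially"
    and f_mono: "mono_on {s 0..} f" and a_mono: "mono_on {s 0..} a"
    and f_nonneg: "\<And>t. 0 \<le> f t" and a_pos: "0 < a (s 0)"
    and ratio: "(\<lambda>k. f (s k) / a (s k)) \<longlonglongrightarrow> 1"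
    and gap: "(\<lambda>k. a (s (Suc k)) / a (s k)) \<longlonglongrightarrow> 1"
  shows "((\<lambda>t. f t / a t) \<longlongrightarrow> 1) at_top"
proof (rule tendstoI)
  fix \<epsilon> :: real assume "\<epsilon> > 0"
  have s0: "s 0 \<le> s k" for k
    using \<open>mono s\<close> by (simp add: monoD)
  have pos: "0 < a t" if "s 0 \<le> t" for t
    using mono_onD[OF a_mono, of "s 0" t] that a_pos by simp
  define u where "u k = f (s (Suc k)) / a (s (Suc k)) * (a (s (Suc k)) / a (s k))" for k
  define l where "l k = f (s k) / a (s k) / (a (s (Suc k)) / a (s k))" for k
  have "u \<longlonglongrightarrow> 1 * 1"
    unfolding u_def by (intro tendsto_mult gap LIMSEQ_Suc[OF ratio])
  moreover have "l \<longlonglongrightarrow> 1 / 1"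
    unfolding l_def by (intro tendsto_divide gap ratio) simp
  ultimately have "eventually (\<lambda>k. dist (u k) 1 < \<epsilon> \<and> dist (l k) 1 < \<epsilon>) sequentially"
    using \<open>\<epsilon> > 0\<close> by (intro eventually_conj tendstoD) simp_all
  then obtain K where K: "\<And>k. k \<ge> K \<Longrightarrow> dist (u k) 1 < \<epsilon> \<and> dist (l k) 1 < \<epsilon>"
    by (auto simp: eventually_sequentially)
  have "dist (f t / a t) 1 < \<epsilon>" if t: "s K \<le> t" for t
  proof -
    obtain k where k: "k \<ge> K" "s k \<le> t" "t \<le> s (Suc k)"
    proof -
      have ex: "\<exists>k. t \<le> s k"
        using s_top unfolding filterlim_at_top by (meson eventually_sequentially order_refl)
      define k' where "k' = (LEAST k. t \<le> s k)"
      have k': "t \<le> s k'"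
        unfolding k'_def using ex by (rule LeastI_ex)
      show ?thesis
      proof (cases "k' \<le> K")
        case True
        then have "t \<le> s K" using k' \<open>mono s\<close> by (meson monoD order_trans)
        then show ?thesis using that[of K] t \<open>mono s\<close> by (meson monoD le_SucI order_refl order_trans)
      next
        case False
        then have "\<not> t \<le> s (k' - 1)"
          unfolding k'_def by (intro not_less_Least) auto
        then show ?thesis using that[of "k' - 1"] False k' by auto
      qed
    qed
    have st: "s 0 \<le> t" using s0[of k] k by simp
    have "f (s k) \<le> f t" "f t \<le> f (s (Suc k))" "a (s k) \<le> a t" "a t \<le> a (s (Suc k))"
      using k s0 st by (auto intro!: mono_onD[OF f_mono] mono_onD[OF a_mono])
    moreover have "u k = f (s (Suc k)) / a (s k)" "l k = f (s k) / a (s (Suc k))"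
      using pos[OF s0, of k] pos[OF s0, of "Suc k"] by (auto simp: u_def l_def)
    ultimately have "f t / a t \<le> u k" "l k \<le> f t / a t"
      using pos[OF s0, of k] pos[OF st] f_nonneg by (auto intro!: frac_le)
    then show ?thesis
      using K[OF k(1)] by (auto simp: dist_real_def abs_less_iff)
  qed
  then show "eventually (\<lambda>t. dist (f t / a t) 1 < \<epsilon>) at_top"
    using eventually_ge_at_top[of "s K"] by (rule eventually_mono[rotated])
qed

text \<open>
  Quadratic growth is fast enough for the reciprocals of \<open>a (s k)\<close> to be summable, and slow enough
  for consecutive values to have ratio tending to \<open>1\<close>. The bound on the increments ensures that the
  first time at which \<open>a\<close> reaches \<open>(k + 1)\<^sup>2\<close> overshoots by at most \<open>R\<close>.
\<close>
lemma subsequence_of_quadratic_growth: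
  fixes a :: "nat \<Rightarrow> real"
  assumes "mono a" "a 0 = 0" and top: "filterlim a at_top sequentially"
    and step: "\<And>n. a (Suc n) \<le> a n + R"
  obtains s :: "nat \<Rightarrow> nat" where "mono s" "filterlim s at_top sequentially"
    "\<And>k. (real k + 1)\<^sup>2 \<le> a (s k)"
    "(\<lambda>k. a (s (Suc k)) / a (s k)) \<longlonglongrightarrow> 1"
proof -
  define s where "s k = (LEAST n. (real k + 1)\<^sup>2 \<le> a n)" for k
  have ex: "\<exists>n. (real k + 1)\<^sup>2 \<le> a n" for k
    using top unfolding filterlim_at_top by (meson eventually_sequentially order_refl)
  have lower: "(real k + 1)\<^sup>2 \<le> a (s k)" for k
    unfolding s_def using ex by (rule LeastI_ex)
  have upper: "a (s k) \<le> (real k + 1)\<^sup>2 + R" for k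
  proof -
    have "s k \<noteq> 0" using lower[of k] \<open>a 0 = 0\<close>
      by (metis add_nonneg_pos not_less of_nat_0_le_iff zero_less_one zero_less_power)
    then have "\<not> (real k + 1)\<^sup>2 \<le> a (s k - 1)"
      unfolding s_def by (intro not_less_Least) auto
    moreover have "a (s k) \<le> a (s k - 1) + R"
      using step[of "s k - 1"] \<open>s k \<noteq> 0\<close> by simp
    ultimately show ?thesis by linarith
  qed
  have "mono s"
  proof (rule monoI)
    fix k l :: nat assume "k \<le> l"
    then have "(real k + 1)\<^sup>2 \<le> (real l + 1)\<^sup>2" by (intro power_mono) auto
    also note lower[of l]
    finally show "s k \<le> s l" unfolding s_def[of k] by (rule Least_le)
  qed
  moreover have "filterlim s at_top sequentially"
    unfolding filterlim_at_top
  proof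
    fix n
    obtain K :: nat where K: "a n < real K" using reals_Archimedean2 by blast
    have "n \<le> s k" if "k \<ge> K" for k
    proof (rule ccontr)
      assume "\<not> n \<le> s k"
      then have "a (s k) \<le> a n" using \<open>mono a\<close> by (simp add: monoD)
      moreover have "real k + 1 \<le> (real k + 1)\<^sup>2" by (simp add: power2_eq_square)
      ultimately show False using lower[of k] K that by linarith
    qed
    then show "eventually (\<lambda>k. n \<le> s k) sequentially"
      by (auto simp: eventually_sequentially)
  qed
  moreover have "(\<lambda>k. a (s (Suc k)) / a (s k)) \<longlonglongrightarrow> 1"
  proof (rule tendsto_sandwich)
    have pos: "0 < a (s k)" for k
      using lower[of k] by (smt (verit) of_nat_0_le_iff zero_less_power)
    show "eventually (\<lambda>k. 1 \<le> a (s (Suc k)) / a (s k)) sequentially"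
      using pos \<open>mono a\<close> \<open>mono s\<close> by (auto simp: monoD)
    have "a (s (Suc k)) / a (s k) \<le> ((real k + 2)\<^sup>2 + R) / (real k + 1)\<^sup>2" for k
    proof (rule frac_le)
      show "a (s (Suc k)) \<le> (real k + 2)\<^sup>2 + R" using upper[of "Suc k"] by (simp add: add.commute)
      then show "0 \<le> (real k + 2)\<^sup>2 + R" using pos[of "Suc k"] by linarith
    qed (use lower[of k] in auto)
    then show "eventually (\<lambda>k. a (s (Suc k)) / a (s k) \<le> ((real k + 2)\<^sup>2 + R) / (real k + 1)\<^sup>2) sequentially"
      by simp
    show "(\<lambda>k. ((real k + 2)\<^sup>2 + R) / (real k + 1)\<^sup>2) \<longlonglongrightarrow> 1"
      by real_asymp
  qed simp
  ultimately show ?thesis using that lower by blast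
qed

section \<open>The normalising function\<close>

text \<open>
  If the items \<open>i\<close> arrive according to Poisson processes of rates \<open>r i\<close>, this is the expected number of
  distinct items by time \<open>t\<close>. The same formula serves as normalisation for the i.i.d. draws, where it
  is the mean only up to a bounded error.
\<close>
definition expected_count :: "('i \<Rightarrow> real) \<Rightarrow> 'i set \<Rightarrow> real \<Rightarrow> real" where
  "expected_count r I t = (\<Sum>\<^sub>\<infinity>i\<in>I. 1 - exp (- r i * t))"

lemma summable_one_minus_exp:
  fixes r :: "'i \<Rightarrow> real"
  assumes "r summable_on I" "\<And>i. i \<in> I \<Longrightarrow> 0 \<le> r i" "0 \<le> t"
  shows "(\<lambda>i. 1 - exp (- r i * t)) summable_on I"
proof (rule summable_on_comparison_test)
  show "(\<lambda>i. r i * t) summable_on I" using assms(1) by (rule summable_on_cmult_left)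
  fix i assume "i \<in> I"
  then show "1 - exp (- r i * t) \<le> r i * t" "0 \<le> 1 - exp (- r i * t)"
    using assms exp_ge_add_one_self[of "- r i * t"] by auto
qed

lemma expected_count_0 [simp]: "expected_count r I 0 = 0"
  by (simp add: expected_count_def)

lemma expected_count_mono:
  fixes r :: "'i \<Rightarrow> real"
  assumes "r summable_on I" "\<And>i. i \<in> I \<Longrightarrow> 0 \<le> r i" "0 \<le> s" "s \<le> t"
  shows "expected_count r I s \<le> expected_count r I t"
  unfolding expected_count_def using assms
  by (intro infsum_mono summable_one_minus_exp) (auto intro!: mult_left_mono)

lemma expected_count_step:
  fixes r :: "'i \<Rightarrow> real"
  assumes "r summable_on I" "\<And>i. i \<in> I \<Longrightarrow> 0 \<le> r i" "0 \<le> t"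
  shows "expected_count r I (t + 1) \<le> expected_count r I t + infsum r I"
proof -
  have "expected_count r I (t + 1) \<le> (\<Sum>\<^sub>\<infinity>i\<in>I. (1 - exp (- r i * t)) + r i)"
    unfolding expected_count_def
  proof (intro infsum_mono summable_on_add summable_one_minus_exp assms)
    fix i assume i: "i \<in> I"
    have "exp (- r i * t) * (1 - exp (- r i)) \<le> 1 * r i"
      using assms i exp_ge_add_one_self[of "- r i"] by (intro mult_mono) auto
    moreover have "exp (- r i * (t + 1)) = exp (- r i * t) * exp (- r i)"
      by (simp add: exp_add[symmetric] algebra_simps)
    ultimately show "1 - exp (- r i * (t + 1)) \<le> 1 - exp (- r i * t) + r i"
      by (simp add: algebra_simps)
  qed (use assms in auto)
  also have "\<dots> = expected_count r I t + infsum r I"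
    unfolding expected_count_def using assms by (intro infsum_add summable_one_minus_exp)
  finally show ?thesis .
qed

lemma expected_count_pos:
  fixes r :: "'i \<Rightarrow> real"
  assumes "r summable_on I" "\<And>i. i \<in> I \<Longrightarrow> 0 \<le> r i" "0 < t" "j \<in> I" "0 < r j"
  shows "0 < expected_count r I t"
proof -
  have "0 < (\<Sum>i\<in>{j}. 1 - exp (- r i * t))" using assms by simp
  also have "\<dots> \<le> expected_count r I t"
    unfolding expected_count_def using assms
    by (intro finite_sum_le_infsum summable_one_minus_exp) auto
  finally show ?thesis .
qed

lemma one_minus_exp_bounds:
  fixes x :: real
  assumes "0 \<le> x"
  shows "min 1 x / 2 \<le> 1 - exp (- x)" "1 - exp (- x) \<le> min 1 x"
proof -
  have ex: "1 + x \<le> exp x" by (rule exp_ge_add_one_self)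
  have "exp (- x) \<le> 1 / (1 + x)"
    using ex assms by (simp add: exp_minus divide_simps)
  moreover have "1 - 1 / (1 + x) = x / (1 + x)" using assms by (simp add: field_simps)
  moreover have "min 1 x / 2 \<le> x / (1 + x)"
    using assms by (cases "x \<le> 1") (auto simp: field_simps mult_left_le)
  ultimately show "min 1 x / 2 \<le> 1 - exp (- x)" by linarith
  show "1 - exp (- x) \<le> min 1 x" using exp_ge_add_one_self[of "- x"] by auto
qed

lemma expected_count_bounds:
  fixes r :: "'i \<Rightarrow> real"
  assumes "r summable_on I" "\<And>i. i \<in> I \<Longrightarrow> 0 \<le> r i" "0 \<le> t"
  shows "(\<Sum>\<^sub>\<infinity>i\<in>I. min 1 (r i * t)) / 2 \<le> expected_count r I t"
    and "expected_count r I t \<le> (\<Sum>\<^sub>\<infinity>i\<in>I. min 1 (r i * t))"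
proof -
  have summ: "(\<lambda>i. min 1 (r i * t)) summable_on I"
    by (rule summable_on_comparison_test[OF summable_on_cmult_left[OF assms(1), of t]])
       (use assms in auto)
  have "(\<Sum>\<^sub>\<infinity>i\<in>I. min 1 (r i * t)) / 2 = (\<Sum>\<^sub>\<infinity>i\<in>I. min 1 (r i * t) / 2)"
    using infsum_cmult_left'[of "\<lambda>i. min 1 (r i * t)" "1/2" I] by simp
  also have "\<dots> \<le> expected_count r I t"
    unfolding expected_count_def
  proof (intro infsum_mono summable_one_minus_exp assms)
    show "(\<lambda>i. min 1 (r i * t) / 2) summable_on I"
      using summable_on_cmult_left[OF summ, of "1/2"] by simp
    show "min 1 (r i * t) / 2 \<le> 1 - exp (- r i * t)" if "i \<in> I" for i
      using one_minus_exp_bounds(1)[of "r i * t"] assms that by simp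
  qed
  finally show "(\<Sum>\<^sub>\<infinity>i\<in>I. min 1 (r i * t)) / 2 \<le> expected_count r I t" .
  show "expected_count r I t \<le> (\<Sum>\<^sub>\<infinity>i\<in>I. min 1 (r i * t))"
    unfolding expected_count_def
  proof (intro infsum_mono summable_one_minus_exp assms summ)
    show "1 - exp (- r i * t) \<le> min 1 (r i * t)" if "i \<in> I" for i
      using one_minus_exp_bounds(2)[of "r i * t"] assms that by simp
  qed
qed

text \<open>
  Any \<open>n\<close> items of positive rate contribute almost \<open>n\<close> for large \<open>t\<close>.
\<close>
lemma filterlim_expected_count:
  fixes r :: "'i \<Rightarrow> real"
  assumes "r summable_on I" "\<And>i. i \<in> I \<Longrightarrow> 0 \<le> r i" "infinite {i\<in>I. 0 < r i}"
  shows "filterlim (expected_count r I) at_top at_top"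
  unfolding filterlim_at_top
proof
  fix Z :: real
  obtain n :: nat where n: "Z < real n" using reals_Archimedean2 by blast
  obtain F where F: "F \<subseteq> {i\<in>I. 0 < r i}" "finite F" "card F = n"
    using infinite_arbitrarily_large[OF assms(3)] by blast
  have "((\<lambda>t. \<Sum>i\<in>F. 1 - exp (- r i * t)) \<longlongrightarrow> (\<Sum>i\<in>F. 1 - 0)) at_top"
  proof (intro tendsto_sum tendsto_diff tendsto_const)
    fix i assume "i \<in> F"
    then have "r i > 0" using F by auto
    then show "((\<lambda>t. exp (- r i * t)) \<longlongrightarrow> 0) at_top" by real_asymp
  qed
  moreover have "Z < (\<Sum>i\<in>F. 1 - (0::real))" using n F by simp
  ultimately have "eventually (\<lambda>t. Z < (\<Sum>i\<in>F. 1 - exp (- r i * t))) at_top"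
    by (rule order_tendstoD)
  then show "eventually (\<lambda>t. Z \<le> expected_count r I t) at_top"
    using eventually_ge_at_top[of 0]
  proof eventually_elim
    case (elim t)
    have "(\<Sum>i\<in>F. 1 - exp (- r i * t)) \<le> expected_count r I t"
      unfolding expected_count_def using assms F elim
      by (intro finite_sum_le_infsum summable_one_minus_exp) auto
    then show ?case using elim by simp
  qed
qed

lemma tendsto_expected_count:
  fixes r :: "'i \<Rightarrow> real"
  assumes "\<And>i. i \<in> I \<Longrightarrow> 0 \<le> r i" "finite {i\<in>I. 0 < r i}"
  shows "(expected_count r I \<longlongrightarrow> real (card {i\<in>I. 0 < r i})) at_top"
proof -
  let ?F = "{i\<in>I. 0 < r i}"
  have "expected_count r I = (\<lambda>t. \<Sum>i\<in>?F. 1 - exp (- r i * t))"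
  proof
    fix t
    have "expected_count r I t = (\<Sum>\<^sub>\<infinity>i\<in>?F. 1 - exp (- r i * t))"
      unfolding expected_count_def using assms(1) by (intro infsum_cong_neutral) force+
    then show "expected_count r I t = (\<Sum>i\<in>?F. 1 - exp (- r i * t))" using assms(2) by simp
  qed
  moreover have "((\<lambda>t. \<Sum>i\<in>?F. 1 - exp (- r i * t)) \<longlongrightarrow> (\<Sum>i\<in>?F. 1 - 0)) at_top"
  proof (intro tendsto_sum tendsto_diff tendsto_const)
    fix i assume "i \<in> ?F"
    then have "r i > 0" by auto
    then show "((\<lambda>t. exp (- r i * t)) \<longlongrightarrow> 0) at_top" by real_asymp
  qed
  ultimately show ?thesis by simp
qed

text \<open>
  The interval from \<open>1 - r\<close> to \<open>exp (- r)\<close> has length at most \<open>r\<^sup>2 / 2\<close>. Taking n-th powers multiplies a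
  difference in it by at most about \<open>n * exp (- n * r)\<close>, and \<open>n * r * exp (- n * r)\<close> is bounded; what remains
  is of order \<open>r\<close>, uniformly in \<open>n\<close>.
\<close>
lemma power_exp_gap:
  fixes q r :: real
  assumes "0 \<le> q" "0 \<le> r" "1 - r \<le> q" "q \<le> exp (- r)"
  shows "exp (- r * real n) - q ^ n \<le> r"
proof (cases "r \<ge> 1 \<or> n = 0")
  case True
  have "0 \<le> q ^ n" "exp (- r * real n) \<le> 1" using assms by auto
  moreover have "n = 0 \<Longrightarrow> ?thesis" using assms by simp
  ultimately show ?thesis using True by linarith
next
  case False
  then obtain m where m: "n = Suc m" by (cases n) auto
  define x where "x = exp (- r)"
  have x: "0 \<le> q" "q \<le> x" "0 \<le> x" "x \<le> 1" using assms by (auto simp: x_def)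
  \<comment> \<open>Taylor expansion of the exponential; the cubic remainder at \<open>- r\<close> is non-positive.\<close>
  have gap: "x - q \<le> r\<^sup>2 / 2"
  proof -
    have "exp (- r) \<le> 1 - r + r\<^sup>2 / 2"
    proof -
      obtain c where c: "\<bar>c\<bar> \<le> \<bar>- r\<bar>"
          "exp (- r) = (\<Sum>k<3. ((- r) ^ k) / fact k) + exp c / fact 3 * (- r) ^ 3"
        using Maclaurin_exp_le[of "- r" 3] by auto
      have "exp c / fact 3 * (- r) ^ 3 \<le> 0" using assms
        by (simp add: mult_nonneg_nonpos)
      then show ?thesis using c(2) by (simp add: eval_nat_numeral)
    qed
    then show ?thesis using assms unfolding x_def by linarith
  qed
  have "x ^ n - q ^ n = (x - q) * (\<Sum>i<n. q ^ (n - Suc i) * x ^ i)"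
    by (rule power_diff_sumr2)
  also have "\<dots> \<le> (x - q) * (\<Sum>i<n. x ^ m)"
  proof (intro mult_left_mono sum_mono)
    fix i assume "i \<in> {..<n}"
    have "q ^ (n - Suc i) * x ^ i \<le> x ^ (n - Suc i) * x ^ i"
      using x by (intro mult_right_mono power_mono) auto
    also have "\<dots> = x ^ m" using \<open>i \<in> {..<n}\<close> m by (simp add: power_add[symmetric])
    finally show "q ^ (n - Suc i) * x ^ i \<le> x ^ m" .
  qed (use x in auto)
  also have "\<dots> = (x - q) * (real n * x ^ m)" by simp
  also have "\<dots> \<le> (r\<^sup>2 / 2) * (real n * x ^ m)"
    using gap x by (intro mult_right_mono) auto
  \<comment> \<open>The first summand in the brackets is \<open>y * exp (- y)\<close> at \<open>y = m * r\<close>; both are at most \<open>1\<close>.\<close>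
  also have "\<dots> = r / 2 * (real m * r * x ^ m + r * x ^ m)"
    by (simp add: m power2_eq_square algebra_simps)
  also have "\<dots> \<le> r / 2 * (1 + 1)"
  proof (intro mult_left_mono add_mono)
    have "x ^ m = exp (- (real m * r))" by (simp add: x_def exp_of_nat_mult[symmetric])
    moreover have "real m * r \<le> exp (real m * r)" 
      using exp_ge_add_one_self[of "real m * r"] by linarith
    ultimately show "real m * r * x ^ m \<le> 1"
      using divide_le_eq_1_pos[of "exp (real m * r)" "real m * r"]
      by (simp add: exp_minus divide_inverse)
    show "r * x ^ m \<le> 1" using False assms x by (intro mult_le_one power_le_one) auto
  qed (use assms in auto)
  finally have "x ^ n - q ^ n \<le> r" by simp
  moreover have "x ^ n = exp (- r * real n)" 
    by (simp add: x_def exp_of_nat_mult[symmetric] mult.commute)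
  ultimately show ?thesis by simp
qed

lemma nn_integral_count_space_eq_infsum:
  fixes f :: "'i \<Rightarrow> real"
  assumes "f summable_on I" "\<And>i. i \<in> I \<Longrightarrow> 0 \<le> f i"
  shows "(\<integral>\<^sup>+i. ennreal (f i) \<partial>count_space I) = ennreal (infsum f I)"
proof -
  have "Infinite_Set_Sum.abs_summable_on f I"
    using assms(1) abs_summable_equivalent summable_on_iff_abs_summable_on_real by blast
  then show ?thesis
    using assms(2) nn_integral_conv_infsetsum[of f I] infsetsum_infsum[of f I] by metis
qed

section \<open>Numbers of occurring events\<close>

context prob_space begin

lemma nn_integral_indicator_count_space:
  "(\<integral>\<^sup>+i. indicator (A i) \<omega> \<partial>count_space I) = emeasure (count_space I) {i\<in>I. \<omega> \<in> A i}"
proof -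
  have "(\<integral>\<^sup>+i. indicator (A i) \<omega> \<partial>count_space I) = (\<integral>\<^sup>+i. indicator {i\<in>I. \<omega> \<in> A i} i \<partial>count_space I)"
    by (intro nn_integral_cong) (auto split: split_indicator)
  then show ?thesis by simp
qed

lemma measurable_nn_integral_indicator_count_space:
  assumes "countable I" "\<And>i. i \<in> I \<Longrightarrow> A i \<in> events"
  shows "(\<lambda>\<omega>. \<integral>\<^sup>+i. indicator (A i) \<omega> \<partial>count_space I) \<in> borel_measurable M"
proof -
  interpret I: sigma_finite_measure "count_space I"
    using assms(1) by (rule sigma_finite_measure_count_space_countable)
  have "(\<lambda>x. indicator (A (snd x)) (fst x) :: ennreal) \<in> borel_measurable (M \<Otimes>\<^sub>M count_space I)"
    by (rule measurable_compose_countable'[where g = snd and I = I and f = "\<lambda>i x. indicator (A i) (fst x)"])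
       (use assms in auto)
  then show ?thesis
    by (intro I.borel_measurable_nn_integral) (simp add: case_prod_beta')
qed

lemma measurable_card_occurring:
  assumes "countable I" "\<And>i. i \<in> I \<Longrightarrow> A i \<in> events"
  shows "(\<lambda>\<omega>. real (card {i\<in>I. \<omega> \<in> A i})) \<in> borel_measurable M"
proof -
  \<comment> \<open>The equation also holds where infinitely many events occur: \<open>card\<close> and \<open>enn2real\<close> then both give \<open>0\<close>.\<close>
  have "real (card {i\<in>I. \<omega> \<in> A i}) = enn2real (\<integral>\<^sup>+i. indicator (A i) \<omega> \<partial>count_space I)" for \<omega>
    by (cases "finite {i\<in>I. \<omega> \<in> A i}")
       (auto simp: nn_integral_indicator_count_space ennreal_of_nat_eq_real_of_nat)
  then show ?thesis
    using measurable_nn_integral_indicator_count_space[OF assms] by simp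
qed

lemma nn_integral_count_space_indicator_events:
  assumes "countable I" "\<And>i. i \<in> I \<Longrightarrow> A i \<in> events" "(\<lambda>i. prob (A i)) summable_on I"
  shows "(\<integral>\<^sup>+\<omega>. (\<integral>\<^sup>+i. indicator (A i) \<omega> \<partial>count_space I) \<partial>M) = ennreal (\<Sum>\<^sub>\<infinity>i\<in>I. prob (A i))"
proof -
  have "(\<integral>\<^sup>+\<omega>. (\<integral>\<^sup>+i. indicator (A i) \<omega> \<partial>count_space I) \<partial>M) =
      (\<integral>\<^sup>+i. (\<integral>\<^sup>+\<omega>. indicator (A i) \<omega> \<partial>M) \<partial>count_space I)"
    using assms by (intro nn_integral_count_space_nn_integral) auto
  also have "\<dots> = (\<integral>\<^sup>+i. ennreal (prob (A i)) \<partial>count_space I)"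
    using assms by (intro nn_integral_cong) (auto simp: emeasure_eq_measure)
  also have "\<dots> = ennreal (\<Sum>\<^sub>\<infinity>i\<in>I. prob (A i))"
    using assms(3) by (intro nn_integral_count_space_eq_infsum) auto
  finally show ?thesis .
qed

lemma AE_finite_occurring:
  assumes "countable I" "\<And>i. i \<in> I \<Longrightarrow> A i \<in> events" "(\<lambda>i. prob (A i)) summable_on I"
  shows "AE \<omega> in M. finite {i\<in>I. \<omega> \<in> A i}"
proof -
  have "AE \<omega> in M. (\<integral>\<^sup>+i. indicator (A i) \<omega> \<partial>count_space I) \<noteq> \<infinity>"
    using nn_integral_count_space_indicator_events[OF assms]
    by (intro nn_integral_PInf_AE measurable_nn_integral_indicator_count_space assms) auto
  then show ?thesis
  proof (rule AE_mp, intro AE_I2 impI)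
    fix \<omega> assume "(\<integral>\<^sup>+i. indicator (A i) \<omega> \<partial>count_space I) \<noteq> \<infinity>"
    then show "finite {i\<in>I. \<omega> \<in> A i}"
      unfolding nn_integral_indicator_count_space
      by (rule contrapos_np) (auto intro: emeasure_count_space_infinite)
  qed
qed

lemma AE_card_occurring:
  assumes "countable I" "\<And>i. i \<in> I \<Longrightarrow> A i \<in> events" "(\<lambda>i. prob (A i)) summable_on I"
  shows "AE \<omega> in M. ennreal (real (card {i\<in>I. \<omega> \<in> A i})) = (\<integral>\<^sup>+i. indicator (A i) \<omega> \<partial>count_space I)"
proof -
  have "AE \<omega> in M. finite {i\<in>I. \<omega> \<in> A i}" by (rule AE_finite_occurring[OF assms])
  then show ?thesis
    by eventually_elim (simp add: nn_integral_indicator_count_space ennreal_of_nat_eq_real_of_nat)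
qed

lemma
  assumes "countable I" "\<And>i. i \<in> I \<Longrightarrow> A i \<in> events" "(\<lambda>i. prob (A i)) summable_on I"
  shows integrable_card_occurring: "integrable M (\<lambda>\<omega>. real (card {i\<in>I. \<omega> \<in> A i}))"
    and expectation_card_occurring:
      "expectation (\<lambda>\<omega>. real (card {i\<in>I. \<omega> \<in> A i})) = (\<Sum>\<^sub>\<infinity>i\<in>I. prob (A i))"
proof -
  have "(\<integral>\<^sup>+\<omega>. ennreal (real (card {i\<in>I. \<omega> \<in> A i})) \<partial>M) = ennreal (\<Sum>\<^sub>\<infinity>i\<in>I. prob (A i))"
    using AE_card_occurring[OF assms] nn_integral_count_space_indicator_events[OF assms]
    by (subst nn_integral_cong_AE) auto
  then have "has_bochner_integral M (\<lambda>\<omega>. real (card {i\<in>I. \<omega> \<in> A i})) (\<Sum>\<^sub>\<infinity>i\<in>I. prob (A i))"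
    using assms by (intro has_bochner_integral_nn_integral measurable_card_occurring)
      (auto intro!: infsum_nonneg)
  then show "integrable M (\<lambda>\<omega>. real (card {i\<in>I. \<omega> \<in> A i}))"
    "expectation (\<lambda>\<omega>. real (card {i\<in>I. \<omega> \<in> A i})) = (\<Sum>\<^sub>\<infinity>i\<in>I. prob (A i))"
    by (auto simp: has_bochner_integral_iff)
qed

text \<open>
  The second moment is the double sum of \<open>prob (A i \<inter> A j)\<close>. The products \<open>prob (A i) * prob (A j)\<close>
  add up to \<open>b\<^sup>2\<close>, the diagonal terms to \<open>b\<close>, and the excesses \<open>prob (D i j)\<close> to at most \<open>b\<close>: for fixed
  \<open>i\<close> the events \<open>D i j\<close> are disjoint parts of \<open>A i\<close>. With extended non-negative integrals the sums
  and expectations can be interchanged before anything is known to be finite.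
\<close>
lemma second_moment_card_occurring:
  fixes A :: "'i \<Rightarrow> 'a set"
  assumes I: "countable I" and A: "\<And>i. i \<in> I \<Longrightarrow> A i \<in> events"
    and summ: "(\<lambda>i. prob (A i)) summable_on I"
    and D: "\<And>i j. i \<in> I \<Longrightarrow> j \<in> I \<Longrightarrow> D i j \<in> events \<and> D i j \<subseteq> A i"
    and disj: "\<And>i. i \<in> I \<Longrightarrow> disjoint_family_on (D i) I"
    and cov: "\<And>i j. i \<in> I \<Longrightarrow> j \<in> I \<Longrightarrow> i \<noteq> j \<Longrightarrow>
      prob (A i \<inter> A j) \<le> prob (A i) * prob (A j) + prob (D i j)"
  defines "b \<equiv> \<Sum>\<^sub>\<infinity>i\<in>I. prob (A i)"
  shows "(\<integral>\<^sup>+\<omega>. ennreal ((real (card {i\<in>I. \<omega> \<in> A i}))\<^sup>2) \<partial>M) \<le> ennreal (b\<^sup>2 + 2 * b)"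
proof -
  let ?C = "count_space I"
  have b: "0 \<le> b" unfolding b_def by (intro infsum_nonneg) auto
  have sum_b: "(\<integral>\<^sup>+j. ennreal (prob (A j)) \<partial>?C) = ennreal b"
    unfolding b_def using summ by (intro nn_integral_count_space_eq_infsum) auto
  \<comment> \<open>One summand \<open>prob (A i)\<close> comes from the diagonal, the other from the union of the \<open>D i j\<close>.\<close>
  have row: "(\<integral>\<^sup>+j. ennreal (prob (A i \<inter> A j)) \<partial>?C) \<le> ennreal (prob (A i) * (b + 2))"
    if i: "i \<in> I" for i
  proof -
    have "(\<integral>\<^sup>+j. ennreal (prob (A i \<inter> A j)) \<partial>?C) \<le>
        (\<integral>\<^sup>+j. ennreal (prob (A i)) * ennreal (prob (A j)) +
              (ennreal (prob (A i)) * indicator {i} j + emeasure M (D i j)) \<partial>?C)"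
    proof (rule nn_integral_mono)
      fix j assume "j \<in> space ?C"
      then have j: "j \<in> I" by simp
      show "ennreal (prob (A i \<inter> A j)) \<le> ennreal (prob (A i)) * ennreal (prob (A j)) +
              (ennreal (prob (A i)) * indicator {i} j + emeasure M (D i j))"
      proof (cases "j = i")
        case True
        have "ennreal (prob (A i \<inter> A j)) \<le> ennreal (prob (A i)) * indicator {i} j" using True by simp
        then show ?thesis by (meson add_increasing add_increasing2 zero_le)
      next
        case False
        then show ?thesis using cov[OF i j]
          by (simp add: emeasure_eq_measure ennreal_mult[symmetric] ennreal_plus[symmetric]
              ennreal_leI del: ennreal_plus)
      qed
    qed
    also have "\<dots> = ennreal (prob (A i)) * ennreal b + (ennreal (prob (A i)) + (\<integral>\<^sup>+j. emeasure M (D i j) \<partial>?C))"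
      using i by (simp add: nn_integral_add nn_integral_cmult sum_b emeasure_count_space)
    also have "(\<integral>\<^sup>+j. emeasure M (D i j) \<partial>?C) = emeasure M (\<Union>j\<in>I. D i j)"
      using I D[OF i] disj[OF i] by (subst emeasure_UN_countable) auto
    also have "\<dots> \<le> emeasure M (A i)"
      using D[OF i] A[OF i] by (intro emeasure_mono) auto
    also have "\<dots> = ennreal (prob (A i))" by (rule emeasure_eq_measure)
    finally show ?thesis
      using b by (simp add: ennreal_mult[symmetric] ennreal_plus[symmetric] algebra_simps
          add_left_mono del: ennreal_plus)
  qed
  have "(\<integral>\<^sup>+\<omega>. ennreal ((real (card {i\<in>I. \<omega> \<in> A i}))\<^sup>2) \<partial>M) =
      (\<integral>\<^sup>+\<omega>. (\<integral>\<^sup>+i. (\<integral>\<^sup>+j. indicator (A i \<inter> A j) \<omega> \<partial>?C) \<partial>?C) \<partial>M)"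
  proof (rule nn_integral_cong_AE)
    have "AE \<omega> in M. ennreal (real (card {i\<in>I. \<omega> \<in> A i})) = (\<integral>\<^sup>+i. indicator (A i) \<omega> \<partial>?C)"
      by (rule AE_card_occurring[OF I A summ])
    then show "AE \<omega> in M. ennreal ((real (card {i\<in>I. \<omega> \<in> A i}))\<^sup>2) =
      (\<integral>\<^sup>+i. (\<integral>\<^sup>+j. indicator (A i \<inter> A j) \<omega> \<partial>?C) \<partial>?C)"
      by eventually_elim (simp add: ennreal_mult indicator_inter_arith nn_integral_cmult
          nn_integral_multc power2_eq_square)
  qed
  also have "\<dots> = (\<integral>\<^sup>+i. (\<integral>\<^sup>+\<omega>. (\<integral>\<^sup>+j. indicator (A i \<inter> A j) \<omega> \<partial>?C) \<partial>M) \<partial>?C)"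
    using I A by (intro nn_integral_count_space_nn_integral measurable_nn_integral_indicator_count_space) auto
  also have "\<dots> = (\<integral>\<^sup>+i. (\<integral>\<^sup>+j. (\<integral>\<^sup>+\<omega>. indicator (A i \<inter> A j) \<omega> \<partial>M) \<partial>?C) \<partial>?C)"
    using I A by (intro nn_integral_cong nn_integral_count_space_nn_integral) auto
  also have "\<dots> = (\<integral>\<^sup>+i. (\<integral>\<^sup>+j. ennreal (prob (A i \<inter> A j)) \<partial>?C) \<partial>?C)"
    using A by (intro nn_integral_cong) (auto simp: emeasure_eq_measure)
  also have "\<dots> \<le> (\<integral>\<^sup>+i. ennreal (prob (A i) * (b + 2)) \<partial>?C)"
    using row by (intro nn_integral_mono) auto
  also have "\<dots> = ennreal b * ennreal (b + 2)"
    using b by (simp add: ennreal_mult nn_integral_multc sum_b)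
  also have "\<dots> = ennreal (b\<^sup>2 + 2 * b)"
    using b by (subst ennreal_mult[symmetric]) (auto simp: power2_eq_square algebra_simps)
  finally show ?thesis .
qed

text \<open>
  Expanding the square about a point \<open>a\<close> that need not be the mean lets the normalisation differ
  from the expectation.
\<close>
lemma second_moment_about:
  fixes X :: "'a \<Rightarrow> real"
  assumes X: "integrable M X" and sq: "(\<integral>\<^sup>+\<omega>. ennreal ((X \<omega>)\<^sup>2) \<partial>M) \<le> ennreal c" and "0 \<le> c"
  shows "(\<integral>\<^sup>+\<omega>. ennreal ((X \<omega> - a)\<^sup>2) \<partial>M) \<le> ennreal (c - 2 * a * expectation X + a\<^sup>2)"
proof -
  have [measurable]: "X \<in> borel_measurable M" using X by simp
  have X2: "integrable M (\<lambda>\<omega>. (X \<omega>)\<^sup>2)"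
    using sq by (intro integrableI_bounded) (auto simp: le_less_trans)
  have "ennreal (expectation (\<lambda>\<omega>. (X \<omega>)\<^sup>2)) \<le> ennreal c"
    using sq X2 by (subst nn_integral_eq_integral[symmetric]) auto
  then have E2: "expectation (\<lambda>\<omega>. (X \<omega>)\<^sup>2) \<le> c" using \<open>0 \<le> c\<close> by (simp add: ennreal_le_iff)
  have eq: "(X \<omega> - a)\<^sup>2 = (X \<omega>)\<^sup>2 - 2 * a * X \<omega> + a\<^sup>2" for \<omega>
    by (simp add: power2_eq_square algebra_simps)
  have int: "integrable M (\<lambda>\<omega>. (X \<omega> - a)\<^sup>2)"
    unfolding eq using X X2 by simp
  have "(\<integral>\<^sup>+\<omega>. ennreal ((X \<omega> - a)\<^sup>2) \<partial>M) = ennreal (expectation (\<lambda>\<omega>. (X \<omega> - a)\<^sup>2))"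
    using int by (intro nn_integral_eq_integral) auto
  also have "expectation (\<lambda>\<omega>. (X \<omega> - a)\<^sup>2) = expectation (\<lambda>\<omega>. (X \<omega>)\<^sup>2) - 2 * a * expectation X + a\<^sup>2"
    unfolding eq using X X2 by (simp add: prob_space)
  finally show ?thesis using E2 by (simp add: ennreal_leI)
qed

end

section \<open>A law of large numbers for growing counts\<close>

text \<open>
  \<open>A n i\<close> is the event that item \<open>i\<close> has occurred by time \<open>n\<close>, an increasing event with rate \<open>r i\<close>. The
  bounds on the survival factor \<open>q i\<close> cover both \<open>q i = exp (- r i)\<close> and \<open>q i = 1 - r i\<close>. The events
  \<open>D n i j\<close> account for a positive correlation of the items \<open>i\<close> and \<open>j\<close>.
\<close>
locale growing_count = prob_space +
  fixes I :: "'i set" and A :: "nat \<Rightarrow> 'i \<Rightarrow> 'a set" and D :: "nat \<Rightarrow> 'i \<Rightarrow> 'i \<Rightarrow> 'a set"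
    and q r :: "'i \<Rightarrow> real"
  assumes countable_I: "countable I"
    and A_event: "i \<in> I \<Longrightarrow> A n i \<in> events"
    and prob_A: "i \<in> I \<Longrightarrow> prob (A n i) = 1 - q i ^ n"
    and q_nonneg: "i \<in> I \<Longrightarrow> 0 \<le> q i"
    and q_lower: "i \<in> I \<Longrightarrow> 1 - r i \<le> q i"
    and q_upper: "i \<in> I \<Longrightarrow> q i \<le> exp (- r i)"
    and r_nonneg: "i \<in> I \<Longrightarrow> 0 \<le> r i"
    and r_summable: "r summable_on I"
    and AE_A_mono: "AE \<omega> in M. \<forall>i\<in>I. \<forall>n. \<omega> \<in> A n i \<longrightarrow> \<omega> \<in> A (Suc n) i"
    and D_event: "i \<in> I \<Longrightarrow> j \<in> I \<Longrightarrow> D n i j \<in> events \<and> D n i j \<subseteq> A n i"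
    and D_disjoint: "i \<in> I \<Longrightarrow> disjoint_family_on (D n i) I"
    and prob_A_Int: "i \<in> I \<Longrightarrow> j \<in> I \<Longrightarrow> i \<noteq> j \<Longrightarrow>
      prob (A n i \<inter> A n j) \<le> prob (A n i) * prob (A n j) + prob (D n i j)"
begin

lemma q_less_1: "i \<in> I \<Longrightarrow> 0 < r i \<Longrightarrow> q i < 1"
  using q_upper[of i] by (auto intro: le_less_trans)

lemma prob_A_bounds:
  assumes "i \<in> I"
  shows "1 - exp (- r i * real n) \<le> prob (A n i)"
    and "prob (A n i) \<le> (1 - exp (- r i * real n)) + r i"
proof -
  have "q i ^ n \<le> exp (- r i) ^ n"
    using assms by (intro power_mono q_upper q_nonneg)
  also have "\<dots> = exp (- r i * real n)"
    by (simp add: exp_of_nat_mult[symmetric] mult.commute)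
  finally show "1 - exp (- r i * real n) \<le> prob (A n i)" using assms by (simp add: prob_A)
  show "prob (A n i) \<le> (1 - exp (- r i * real n)) + r i"
    using power_exp_gap[OF q_nonneg r_nonneg q_lower q_upper, OF assms assms assms assms, of n] assms
    by (simp add: prob_A)
qed

lemma summable_prob_A: "(\<lambda>i. prob (A n i)) summable_on I"
proof (rule summable_on_comparison_test)
  show "(\<lambda>i. (1 - exp (- r i * real n)) + r i) summable_on I"
    by (intro summable_on_add summable_one_minus_exp r_summable r_nonneg) auto
qed (use prob_A_bounds in auto)

lemma expectation_bounds:
  defines "b \<equiv> \<lambda>n. \<Sum>\<^sub>\<infinity>i\<in>I. prob (A n i)"
  shows "expected_count r I (real n) \<le> b n" and "b n \<le> expected_count r I (real n) + infsum r I"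
proof -
  have s: "(\<lambda>i. 1 - exp (- r i * real n)) summable_on I"
    by (intro summable_one_minus_exp r_summable r_nonneg) auto
  show "expected_count r I (real n) \<le> b n"
    unfolding expected_count_def b_def using s summable_prob_A prob_A_bounds(1)
    by (intro infsum_mono)
  have "b n \<le> (\<Sum>\<^sub>\<infinity>i\<in>I. (1 - exp (- r i * real n)) + r i)"
    unfolding b_def using s summable_prob_A prob_A_bounds(2) r_summable
    by (intro infsum_mono summable_on_add)
  also have "\<dots> = expected_count r I (real n) + infsum r I"
    unfolding expected_count_def using s r_summable by (rule infsum_add)
  finally show "b n \<le> expected_count r I (real n) + infsum r I" .
qed

abbreviation count :: "nat \<Rightarrow> 'a \<Rightarrow> real" where
  "count n \<omega> \<equiv> real (card {i\<in>I. \<omega> \<in> A n i})"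

text \<open>
  With \<open>b\<close> the mean and \<open>a\<close> the normalisation, expanding about \<open>a\<close> gives at most
  \<open>(b - a)\<^sup>2 + 2 * b\<close>, and \<open>b - a\<close> lies between \<open>0\<close> and \<open>R\<close>.
\<close>
lemma second_moment_about_expected_count:
  fixes n :: nat
  defines "R \<equiv> infsum r I" and "a \<equiv> expected_count r I (real n)"
  shows "(\<integral>\<^sup>+\<omega>. ennreal ((count n \<omega> - a)\<^sup>2) \<partial>M) \<le> ennreal (R\<^sup>2 + 2 * R + 2 * a)"
proof -
  define b where "b = (\<Sum>\<^sub>\<infinity>i\<in>I. prob (A n i))"
  have b: "0 \<le> b" "a \<le> b" "b \<le> a + R" 
    using expectation_bounds[of n] by (auto simp: b_def a_def R_def intro!: infsum_nonneg)
  have "(\<integral>\<^sup>+\<omega>. ennreal ((count n \<omega>)\<^sup>2) \<partial>M) \<le> ennreal (b\<^sup>2 + 2 * b)"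
    unfolding b_def
    by (rule second_moment_card_occurring[where D = "D n"])
       (use countable_I A_event summable_prob_A D_event D_disjoint prob_A_Int in auto)
  then have "(\<integral>\<^sup>+\<omega>. ennreal ((count n \<omega> - a)\<^sup>2) \<partial>M) \<le>
      ennreal (b\<^sup>2 + 2 * b - 2 * a * expectation (count n) + a\<^sup>2)"
    using b(1) by (intro second_moment_about integrable_card_occurring countable_I A_event summable_prob_A) auto
  also have "expectation (count n) = b"
    unfolding b_def by (intro expectation_card_occurring countable_I A_event summable_prob_A)
  also have "b\<^sup>2 + 2 * b - 2 * a * b + a\<^sup>2 = (b - a)\<^sup>2 + 2 * b"
    by (simp add: power2_eq_square algebra_simps)
  also have "(b - a)\<^sup>2 \<le> R\<^sup>2" using b by (intro power_mono) auto
  then have "ennreal ((b - a)\<^sup>2 + 2 * b) \<le> ennreal (R\<^sup>2 + 2 * R + 2 * a)"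
    using b by (intro ennreal_leI) linarith
  finally show ?thesis .
qed

lemma AE_finite_all: "AE \<omega> in M. \<forall>n. finite {i\<in>I. \<omega> \<in> A n i}"
  unfolding AE_all_countable
  by (intro allI AE_finite_occurring countable_I A_event summable_prob_A)

lemma AE_count_mono: "AE \<omega> in M. mono (\<lambda>n. count n \<omega>)"
  using AE_finite_all AE_A_mono
proof eventually_elim
  case (elim \<omega>)
  show ?case
  proof (rule incseq_SucI)
    fix n
    have "{i\<in>I. \<omega> \<in> A n i} \<subseteq> {i\<in>I. \<omega> \<in> A (Suc n) i}" using elim by auto
    then show "count n \<omega> \<le> count (Suc n) \<omega>" using elim by (simp add: card_mono)
  qed
qed

text \<open>
  Along times \<open>s k\<close> at which the normalisation is about \<open>k\<^sup>2\<close>, the squared relative errors \<open>Z k\<close> have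
  summable expectations. Their sum is then almost surely finite, so they tend to \<open>0\<close>.
\<close>
lemma AE_ratio_tendsto_1_infinite:
  assumes "infinite {i\<in>I. 0 < r i}"
  shows "AE \<omega> in M. (\<lambda>n. count n \<omega> / expected_count r I (real n)) \<longlonglongrightarrow> 1"
proof -
  define a where "a n = expected_count r I (real n)" for n
  define R where "R = infsum r I"
  have a_mono: "mono a"
    unfolding a_def by (auto intro!: monoI expected_count_mono r_summable r_nonneg)
  have a_0: "a 0 = 0" by (simp add: a_def)
  have a_top: "filterlim a at_top sequentially"
    unfolding a_def
    by (rule filterlim_compose[OF filterlim_expected_count filterlim_real_sequentially])
       (use assms r_summable r_nonneg in auto)
  have a_step: "a (Suc n) \<le> a n + R" for n
  proof -
    have "expected_count r I (real n + 1) \<le> expected_count r I (real n) + infsum r I"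
      by (intro expected_count_step r_summable r_nonneg) auto
    then show ?thesis by (simp add: a_def R_def add.commute)
  qed
  obtain s :: "nat \<Rightarrow> nat" where s: "mono s" "filterlim s at_top sequentially"
    "\<And>k. (real k + 1)\<^sup>2 \<le> a (s k)" "(\<lambda>k. a (s (Suc k)) / a (s k)) \<longlonglongrightarrow> 1"
    by (rule subsequence_of_quadratic_growth[where a = a, OF a_mono a_0 a_top a_step]) (rule that)
  have a_ge1: "1 \<le> a (s k)" for k
    using s(3)[of k] by (smt (verit) of_nat_0_le_iff one_le_power)
  define Z where "Z k \<omega> = ((count (s k) \<omega> - a (s k)) / a (s k))\<^sup>2" for k \<omega>
  define c where "c = R\<^sup>2 + 2 * R + 2"
  have R: "0 \<le> R" unfolding R_def by (intro infsum_nonneg r_nonneg)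
  then have c: "0 \<le> c" by (simp add: c_def)
  have meas: "count n \<in> borel_measurable M" for n
    by (intro measurable_card_occurring countable_I A_event)
  have Z_meas: "(\<lambda>\<omega>. ennreal (Z k \<omega>)) \<in> borel_measurable M" for k
    unfolding Z_def using meas[of "s k"] by measurable
  have Z_bound: "(\<integral>\<^sup>+\<omega>. ennreal (Z k \<omega>) \<partial>M) \<le> ennreal (c / (real k + 1)\<^sup>2)" for k
  proof -
    let ?a = "a (s k)"
    have "(\<integral>\<^sup>+\<omega>. ennreal (Z k \<omega>) \<partial>M) =
        (\<integral>\<^sup>+\<omega>. ennreal (1 / ?a\<^sup>2) * ennreal ((count (s k) \<omega> - ?a)\<^sup>2) \<partial>M)"
      by (simp add: Z_def ennreal_mult[symmetric] power_divide)
    also have "\<dots> = ennreal (1 / ?a\<^sup>2) * (\<integral>\<^sup>+\<omega>. ennreal ((count (s k) \<omega> - ?a)\<^sup>2) \<partial>M)"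
      by (intro nn_integral_cmult measurable_compose[OF _ measurable_ennreal] borel_measurable_power
          borel_measurable_diff meas borel_measurable_const)
    also have "\<dots> \<le> ennreal (1 / ?a\<^sup>2) * ennreal (R\<^sup>2 + 2 * R + 2 * ?a)"
      using second_moment_about_expected_count[of "s k"]
      by (intro mult_left_mono) (auto simp: a_def R_def)
    also have "\<dots> = ennreal ((R\<^sup>2 + 2 * R + 2 * ?a) / ?a\<^sup>2)"
      using R a_ge1[of k] by (subst ennreal_mult[symmetric]) auto
    also have "\<dots> \<le> ennreal (c / (real k + 1)\<^sup>2)"
    proof (rule ennreal_leI)
      have "R\<^sup>2 + 2 * R \<le> (R\<^sup>2 + 2 * R) * ?a"
        using R mult_left_mono[OF a_ge1[of k], of "R\<^sup>2 + 2 * R"] by simp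
      then have "R\<^sup>2 + 2 * R + 2 * ?a \<le> c * ?a" by (simp add: c_def algebra_simps)
      then have "(R\<^sup>2 + 2 * R + 2 * ?a) / ?a\<^sup>2 \<le> c * ?a / ?a\<^sup>2"
        by (intro divide_right_mono) auto
      also have "\<dots> = c / ?a" using a_ge1[of k] by (simp add: power2_eq_square)
      also have "\<dots> \<le> c / (real k + 1)\<^sup>2"
        using c s(3)[of k] by (intro divide_left_mono mult_pos_pos) (use a_ge1[of k] in auto)
      finally show "(R\<^sup>2 + 2 * R + 2 * ?a) / ?a\<^sup>2 \<le> c / (real k + 1)\<^sup>2" .
    qed
    finally show ?thesis .
  qed
  have "(\<integral>\<^sup>+\<omega>. (\<Sum>k. ennreal (Z k \<omega>)) \<partial>M) = (\<Sum>k. \<integral>\<^sup>+\<omega>. ennreal (Z k \<omega>) \<partial>M)"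
    using Z_meas by (rule nn_integral_suminf)
  also have "\<dots> \<le> (\<Sum>k. ennreal (c / (real k + 1)\<^sup>2))"
    using Z_bound by (intro suminf_le) auto
  also have "\<dots> < \<infinity>"
  proof -
    have "summable (\<lambda>k. inverse (real (Suc k) ^ 2))"
      using inverse_power_summable[of 2, where 'a = real] by (subst summable_Suc_iff) auto
    then have "summable (\<lambda>k. c / (real k + 1)\<^sup>2)"
      using summable_mult[of _ c] by (simp add: divide_inverse add.commute)
    then show ?thesis using c by (simp add: suminf_ennreal2)
  qed
  finally have "AE \<omega> in M. (\<Sum>k. ennreal (Z k \<omega>)) \<noteq> \<infinity>"
    using Z_meas by (intro nn_integral_PInf_AE borel_measurable_suminf) auto
  then show ?thesis
    using AE_count_mono
  proof eventually_elim
    case (elim \<omega>)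
    have "summable (\<lambda>k. Z k \<omega>)"
      using elim(1) by (intro summable_suminf_not_top) (auto simp: Z_def)
    then have "(\<lambda>k. Z k \<omega>) \<longlonglongrightarrow> 0" by (rule summable_LIMSEQ_zero)
    then have "(\<lambda>k. sqrt (Z k \<omega>)) \<longlonglongrightarrow> sqrt 0" by (rule tendsto_real_sqrt)
    then have "(\<lambda>k. (count (s k) \<omega> - a (s k)) / a (s k)) \<longlonglongrightarrow> 0"
      unfolding Z_def real_sqrt_abs real_sqrt_zero by (rule tendsto_rabs_zero_cancel)
    then have "(\<lambda>k. (count (s k) \<omega> - a (s k)) / a (s k) + 1) \<longlonglongrightarrow> 0 + 1"
      by (intro tendsto_add tendsto_const)
    moreover have "(count (s k) \<omega> - a (s k)) / a (s k) + 1 = count (s k) \<omega> / a (s k)" for k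
      using a_ge1[of k] by (simp add: field_simps)
    ultimately have "(\<lambda>k. count (s k) \<omega> / a (s k)) \<longlonglongrightarrow> 1" by simp
    then have "(\<lambda>n. count n \<omega> / a n) \<longlonglongrightarrow> 1"
    proof (rule ratio_tendsto_1_of_subsequence[rotated -2])
      show "mono_on {s 0..} (\<lambda>n. count n \<omega>)" "mono_on {s 0..} a"
        using elim(2) a_mono by (blast intro: mono_imp_mono_on)+
      show "0 < a (s 0)" using a_ge1[of 0] by simp
    qed (use s in simp_all)
    then show ?case by (simp add: a_def)
  qed
qed

lemma AE_eventually_occurs:
  assumes "i \<in> I" "0 < r i"
  shows "AE \<omega> in M. \<exists>n. \<omega> \<in> A n i"
proof -
  define B where "B = space M - (\<Union>n. A n i)"
  have B: "B \<in> events" unfolding B_def using A_event[OF assms(1)] by auto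
  have "prob B \<le> q i ^ n" for n
  proof -
    have "prob B \<le> prob (space M - A n i)"
      using A_event[OF assms(1)] by (intro finite_measure_mono) (auto simp: B_def)
    also have "\<dots> = q i ^ n" using A_event[OF assms(1)] assms by (simp add: prob_compl prob_A)
    finally show ?thesis .
  qed
  moreover have "(\<lambda>n. q i ^ n) \<longlonglongrightarrow> 0"
    using assms q_nonneg q_less_1 by (intro LIMSEQ_power_zero) auto
  ultimately have "prob B \<le> 0" by (intro LIMSEQ_le_const) auto
  then have "prob B = 0" by (simp add: measure_le_0_iff)
  then show ?thesis
    using B by (auto simp: prob_eq_0 B_def elim!: AE_mp intro!: AE_I2)
qed

lemma AE_never_occurs:
  assumes "i \<in> I" "\<not> 0 < r i"
  shows "AE \<omega> in M. \<omega> \<notin> A n i"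
proof -
  have "r i = 0" using assms r_nonneg[of i] by simp
  then have "q i = 1" using q_lower[OF assms(1)] q_upper[OF assms(1)] by simp
  then show ?thesis using prob_A[OF assms(1), of n] A_event[OF assms(1), of n] by (simp add: prob_eq_0)
qed

text \<open>
  Almost surely the items of positive rate all occur sooner or later and the others never do, so the
  count is eventually constant; the normalisation has the same limit.
\<close>
lemma AE_ratio_tendsto_1_finite:
  assumes fin: "finite {i\<in>I. 0 < r i}" and ne: "{i\<in>I. 0 < r i} \<noteq> {}"
  shows "AE \<omega> in M. (\<lambda>n. count n \<omega> / expected_count r I (real n)) \<longlonglongrightarrow> 1"
proof -
  let ?F = "{i\<in>I. 0 < r i}"
  have "AE \<omega> in M. \<forall>i\<in>?F. \<exists>n. \<omega> \<in> A n i"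
    using fin AE_eventually_occurs by (subst AE_ball_countable) (auto intro: countable_finite)
  moreover have "AE \<omega> in M. \<forall>i\<in>I - ?F. \<forall>n. \<omega> \<notin> A n i"
    using countable_I AE_never_occurs by (subst AE_ball_countable) (auto simp: AE_all_countable)
  ultimately show ?thesis
    using AE_A_mono
  proof eventually_elim
    case (elim \<omega>)
    have mono: "\<omega> \<in> A n i" if "m \<le> n" "\<omega> \<in> A m i" "i \<in> I" for m n i
      using that elim(3) by (induction rule: dec_induct) auto
    have "eventually (\<lambda>n. \<forall>i\<in>?F. \<omega> \<in> A n i) sequentially"
      using fin elim(1) mono by (intro eventually_ball_finite) (auto simp: eventually_sequentially, metis)
    then have "eventually (\<lambda>n. real (card ?F) = count n \<omega>) sequentially"
    proof eventually_elim
      case (elim n)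
      then have "{i\<in>I. \<omega> \<in> A n i} = ?F" using \<open>\<forall>i\<in>I - ?F. \<forall>n. \<omega> \<notin> A n i\<close> by auto
      then show ?case by simp
    qed
    then have "(\<lambda>n. count n \<omega>) \<longlonglongrightarrow> real (card ?F)"
      by (rule Lim_transform_eventually[OF tendsto_const])
    moreover have "(\<lambda>n. expected_count r I (real n)) \<longlonglongrightarrow> real (card ?F)"
      by (rule filterlim_compose[OF tendsto_expected_count filterlim_real_sequentially])
         (use r_nonneg fin in auto)
    ultimately have "(\<lambda>n. count n \<omega> / expected_count r I (real n)) \<longlonglongrightarrow> real (card ?F) / real (card ?F)"
      using fin ne by (intro tendsto_divide) auto
    moreover have "card ?F \<noteq> 0" using fin ne by (simp only: card_eq_0_iff) blast
    ultimately show ?case by (simp only: divide_self_if of_nat_eq_0_iff if_False)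
  qed
qed

lemma AE_ratio_tendsto_1:
  assumes "i \<in> I" "0 < r i"
  shows "AE \<omega> in M. (\<lambda>n. count n \<omega> / expected_count r I (real n)) \<longlonglongrightarrow> 1"
  using AE_ratio_tendsto_1_finite AE_ratio_tendsto_1_infinite assms by blast

end

section \<open>Graph counts from avoidance probabilities\<close>

lemma power_midpoint_convex:
  fixes u v h :: real
  assumes "0 \<le> u" "0 \<le> v" "0 \<le> h" "2 * h \<le> u + v"
  shows "2 * h ^ n \<le> u ^ n + v ^ n"
proof -
  define m where "m = (u + v) / 2"
  have "2 * m ^ n \<le> u ^ n + v ^ n"
  proof (induction n)
    case (Suc n)
    have "0 \<le> (u - v) * (u ^ n - v ^ n)"
      using assms power_mono[of u v n] power_mono[of v u n]
      by (cases "u \<le> v") (auto intro: mult_nonpos_nonpos)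
    then have "(u + v) * (u ^ n + v ^ n) \<le> 2 * (u ^ Suc n + v ^ Suc n)"
      by (simp add: algebra_simps)
    moreover have "2 * m ^ Suc n \<le> m * (u ^ n + v ^ n)"
      using mult_left_mono[OF Suc.IH, of m] assms by (simp add: m_def)
    ultimately show ?case by (simp add: m_def)
  qed simp
  moreover have "h ^ n \<le> m ^ n"
    using assms by (intro power_mono) (auto simp: m_def)
  ultimately show ?thesis by linarith
qed

text \<open>
  Covariances do not change when both events are replaced by their complements. Avoidance
  probabilities give direct access to the complements only.
\<close>
lemma (in prob_space) prob_Int_le_of_compl:
  assumes "A \<in> events" "B \<in> events"
    and "prob ((space M - A) \<inter> (space M - B)) \<le> prob (space M - A) * prob (space M - B) + d"
  shows "prob (A \<inter> B) \<le> prob A * prob B + d"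
proof -
  have "(space M - A) \<inter> (space M - B) = space M - (A \<union> B)" by auto
  then have "prob ((space M - A) \<inter> (space M - B)) = 1 - prob (A \<union> B)"
    using assms by (simp add: prob_compl)
  moreover have "prob (A \<union> B) = prob A + prob B - prob (A \<inter> B)"
    using assms by (intro measure_Un3) (auto simp: fmeasurable_eq_sets)
  ultimately show ?thesis using assms by (simp add: prob_compl algebra_simps)
qed

definition star :: "nat \<Rightarrow> nat set set" where
  "star i = {e\<in>all_edges. i \<in> e}"

lemma mem_all_edgesE:
  assumes "e \<in> all_edges"
  obtains i j where "e = {i, j}" "1 \<le> i" "i < j"
  using assms by (auto simp: all_edges_def index_pairs_def)

lemma countable_all_edges: "countable all_edges"
  unfolding all_edges_def by (intro countable_image) (auto intro: countable_subset)

lemma star_subset: "star i \<subseteq> all_edges"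
  by (auto simp: star_def)

lemma star_Int_star:
  assumes "i \<noteq> j"
  shows "star i \<inter> star j = all_edges \<inter> {{i, j}}"
proof -
  have "e = {i, j}" if e: "e \<in> all_edges" "i \<in> e" "j \<in> e" for e
  proof -
    obtain a b where "e = {a, b}" using e(1) by (rule mem_all_edgesE)
    then show ?thesis using e assms by auto
  qed
  then show ?thesis by (auto simp: star_def)
qed

text \<open>
  In the double sum over pairs of a vertex and an edge at it, each edge is counted twice.
\<close>
lemma summable_star_weights:
  fixes w :: "nat set \<Rightarrow> real"
  assumes "w summable_on all_edges" "\<And>e. e \<in> all_edges \<Longrightarrow> 0 \<le> w e"
  shows "(\<lambda>i. infsum w (star i)) summable_on {1..}"
proof -
  have fin: "finite e \<and> card e = 2 \<and> (\<forall>i\<in>e. 1 \<le> i)" if "e \<in> all_edges" for e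
    using that by (auto elim!: mem_all_edgesE)
  have by_edge: "(\<lambda>(e, i). w e) summable_on Sigma all_edges (\<lambda>e. e)"
  proof (rule summable_on_SigmaI)
    show "((\<lambda>i. case (e, i) of (e, i) \<Rightarrow> w e) has_sum (2 * w e)) e" if "e \<in> all_edges" for e
      using fin[OF that] by (intro has_sum_finiteI) auto
    show "(\<lambda>e. 2 * w e) summable_on all_edges" using assms(1) by (rule summable_on_cmult_right)
  qed (use assms in auto)
  have "(\<lambda>(e, i). w e) summable_on Sigma all_edges (\<lambda>e. e) \<longleftrightarrow>
      (\<lambda>(i, e). w e) summable_on Sigma {1..} star"
    by (rule summable_on_reindex_bij_witness[where i = prod.swap and j = prod.swap])
       (use fin in \<open>auto simp: star_def\<close>)
  then have "(\<lambda>(i, e). w e) summable_on Sigma {1..} star" using by_edge by (rule iffD1)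
  then have "(\<lambda>i. infsum (\<lambda>e. case (i, e) of (i, e) \<Rightarrow> w e) (star i)) summable_on {1..}"
    by (rule summable_on_SigmaD) (use summable_on_subset_banach[OF assms(1) star_subset] in auto)
  then show ?thesis by simp
qed

text \<open>
  \<open>E n\<close> is the set of edges at time \<open>n\<close>; the edges of a set of total weight \<open>x\<close> are all absent with
  probability \<open>(g x)\<^sup>n\<close>. The last two inequalities are correlation bounds at time \<open>1\<close>: \<open>g_add\<close> says that
  absences of disjoint sets of edges are non-positively correlated, and \<open>g_overlap\<close> is needed for two
  stars of weights \<open>a\<close> and \<open>b\<close> that share an edge of weight \<open>x\<close>. Since the probabilities are powers
  of \<open>g\<close>, both inequalities carry over to every time \<open>n\<close>.
\<close>
locale growing_edge_set = prob_space +
  fixes w :: "nat set \<Rightarrow> real" and g :: "real \<Rightarrow> real" and E :: "nat \<Rightarrow> 'a \<Rightarrow> nat set set"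
  assumes w_nonneg: "e \<in> all_edges \<Longrightarrow> 0 \<le> w e"
    and w_summable: "w summable_on all_edges"
    and w_pos: "0 < infsum w all_edges"
    and E_subset: "\<omega> \<in> space M \<Longrightarrow> E n \<omega> \<subseteq> all_edges"
    and AE_E_mono: "AE \<omega> in M. \<forall>n. E n \<omega> \<subseteq> E (Suc n) \<omega>"
    and avoid_event: "S \<subseteq> all_edges \<Longrightarrow> {\<omega>\<in>space M. E n \<omega> \<inter> S = {}} \<in> events"
    and prob_avoid: "S \<subseteq> all_edges \<Longrightarrow> prob {\<omega>\<in>space M. E n \<omega> \<inter> S = {}} = g (infsum w S) ^ n"
    and g_nonneg: "0 \<le> x \<Longrightarrow> x \<le> infsum w all_edges \<Longrightarrow> 0 \<le> g x"
    and g_lower: "0 \<le> x \<Longrightarrow> x \<le> infsum w all_edges \<Longrightarrow> 1 - x \<le> g x"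
    and g_upper: "0 \<le> x \<Longrightarrow> x \<le> infsum w all_edges \<Longrightarrow> g x \<le> exp (- x)"
    and g_add: "0 \<le> x \<Longrightarrow> 0 \<le> y \<Longrightarrow> x + y \<le> infsum w all_edges \<Longrightarrow> g (x + y) \<le> g x * g y"
    and g_overlap: "0 \<le> x \<Longrightarrow> x \<le> a \<Longrightarrow> x \<le> b \<Longrightarrow> a + b - x \<le> infsum w all_edges \<Longrightarrow>
      2 * g (a + b - x) \<le> g a * g b + g (a + b - 2 * x)"
begin

lemma summable_subset: "S \<subseteq> all_edges \<Longrightarrow> w summable_on S"
  using w_summable by (rule summable_on_subset_banach)

lemma weight_nonneg: "S \<subseteq> all_edges \<Longrightarrow> 0 \<le> infsum w S"
  using w_nonneg by (intro infsum_nonneg) auto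

lemma weight_mono: "S \<subseteq> T \<Longrightarrow> T \<subseteq> all_edges \<Longrightarrow> infsum w S \<le> infsum w T"
  using w_nonneg by (intro infsum_mono2 summable_subset) auto

abbreviation avoid :: "nat \<Rightarrow> nat set set \<Rightarrow> 'a set" where
  "avoid n S \<equiv> {\<omega>\<in>space M. E n \<omega> \<inter> S = {}}"

lemma meets_eq: "{\<omega>\<in>space M. E n \<omega> \<inter> S \<noteq> {}} = space M - avoid n S"
  by auto

lemma meets_event: "S \<subseteq> all_edges \<Longrightarrow> {\<omega>\<in>space M. E n \<omega> \<inter> S \<noteq> {}} \<in> events"
  unfolding meets_eq by (intro sets.compl_sets avoid_event)

lemma compl_meets: "space M - {\<omega>\<in>space M. E n \<omega> \<inter> S \<noteq> {}} = avoid n S"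
  by auto

lemma prob_meets:
  assumes "S \<subseteq> all_edges"
  shows "prob {\<omega>\<in>space M. E n \<omega> \<inter> S \<noteq> {}} = 1 - g (infsum w S) ^ n"
  unfolding meets_eq using avoid_event prob_avoid assms by (simp add: prob_compl)

lemma prob_meets_Int_le:
  assumes "S \<subseteq> all_edges" "T \<subseteq> all_edges"
    and "prob (avoid n (S \<union> T)) \<le> prob (avoid n S) * prob (avoid n T) + d"
  shows "prob ({\<omega>\<in>space M. E n \<omega> \<inter> S \<noteq> {}} \<inter> {\<omega>\<in>space M. E n \<omega> \<inter> T \<noteq> {}}) \<le>
    prob {\<omega>\<in>space M. E n \<omega> \<inter> S \<noteq> {}} * prob {\<omega>\<in>space M. E n \<omega> \<inter> T \<noteq> {}} + d"
proof (rule prob_Int_le_of_compl)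
  have "avoid n (S \<union> T) = avoid n S \<inter> avoid n T" by auto
  then show "prob ((space M - {\<omega>\<in>space M. E n \<omega> \<inter> S \<noteq> {}}) \<inter> (space M - {\<omega>\<in>space M. E n \<omega> \<inter> T \<noteq> {}}))
    \<le> prob (space M - {\<omega>\<in>space M. E n \<omega> \<inter> S \<noteq> {}}) * prob (space M - {\<omega>\<in>space M. E n \<omega> \<inter> T \<noteq> {}}) + d"
    using assms(3) by (simp add: compl_meets)
qed (use assms meets_event in auto)

text \<open>
  Distinct edges are non-positively correlated by \<open>g_add\<close>, whence the empty correction events.
\<close>
sublocale edges: growing_count M all_edges "\<lambda>n e. {\<omega>\<in>space M. E n \<omega> \<inter> {e} \<noteq> {}}"
  "\<lambda>_ _ _. {}" "\<lambda>e. g (w e)" w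
proof
  have le: "w e \<le> infsum w all_edges" if "e \<in> all_edges" for e
    using weight_mono[of "{e}" all_edges] that by simp
  show "countable all_edges" by (rule countable_all_edges)
  fix e n assume e: "e \<in> all_edges"
  show "{\<omega>\<in>space M. E n \<omega> \<inter> {e} \<noteq> {}} \<in> events" using e by (intro meets_event) auto
  show "prob {\<omega>\<in>space M. E n \<omega> \<inter> {e} \<noteq> {}} = 1 - g (w e) ^ n"
    using prob_meets[of "{e}" n] e by simp
  show "0 \<le> w e" using e by (rule w_nonneg)
  then show "0 \<le> g (w e)" "1 - w e \<le> g (w e)" "g (w e) \<le> exp (- w e)"
    using e le g_nonneg g_lower g_upper by auto
  fix e' assume e': "e' \<in> all_edges" "e \<noteq> e'"
  have w2: "infsum w {e, e'} = w e + w e'" using e' by simp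
  have "g (w e + w e') ^ n \<le> (g (w e) * g (w e')) ^ n"
    using g_nonneg[of "w e + w e'"] g_add[of "w e" "w e'"] w_nonneg e e' weight_mono[of "{e, e'}" all_edges] w2
    by (intro power_mono) auto
  then have "prob (avoid n ({e} \<union> {e'})) \<le> prob (avoid n {e}) * prob (avoid n {e'}) + 0"
    using e e' w2 prob_avoid[of "{e, e'}" n] prob_avoid[of "{e}" n] prob_avoid[of "{e'}" n]
    by (simp add: power_mult_distrib insert_commute add.commute)
  then show "prob ({\<omega>\<in>space M. E n \<omega> \<inter> {e} \<noteq> {}} \<inter> {\<omega>\<in>space M. E n \<omega> \<inter> {e'} \<noteq> {}}) \<le>
    prob {\<omega>\<in>space M. E n \<omega> \<inter> {e} \<noteq> {}} * prob {\<omega>\<in>space M. E n \<omega> \<inter> {e'} \<noteq> {}} + prob {}"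
    using prob_meets_Int_le[of "{e}" "{e'}" n 0] e e' by simp
next
  show "w summable_on all_edges" by (rule w_summable)
  show "AE \<omega> in M. \<forall>e\<in>all_edges. \<forall>n. \<omega> \<in> {\<omega>\<in>space M. E n \<omega> \<inter> {e} \<noteq> {}} \<longrightarrow>
      \<omega> \<in> {\<omega>\<in>space M. E (Suc n) \<omega> \<inter> {e} \<noteq> {}}"
    using AE_E_mono by eventually_elim auto
qed (auto simp: disjoint_family_on_def)

lemma obtain_positive_edge:
  obtains e where "e \<in> all_edges" "0 < w e"
proof (rule ccontr)
  assume "\<not> thesis"
  then have "w e = 0" if "e \<in> all_edges" for e
    using that w_nonneg[of e] \<open>\<And>e. \<lbrakk>e \<in> all_edges; 0 < w e\<rbrakk> \<Longrightarrow> thesis\<close> by fastforce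
  then have "infsum w all_edges = 0" by (rule infsum_0)
  then show False using w_pos by simp
qed

lemma AE_num_edges_ratio:
  "AE \<omega> in M. (\<lambda>n. real (card (E n \<omega>)) / expected_count w all_edges (real n)) \<longlonglongrightarrow> 1"
proof -
  obtain e where "e \<in> all_edges" "0 < w e" by (rule obtain_positive_edge)
  then have "AE \<omega> in M. (\<lambda>n. edges.count n \<omega> / expected_count w all_edges (real n)) \<longlonglongrightarrow> 1"
    by (rule edges.AE_ratio_tendsto_1)
  then show ?thesis
  proof (rule AE_mp, intro AE_I2 impI)
    fix \<omega> assume *: "\<omega> \<in> space M" "(\<lambda>n. edges.count n \<omega> / expected_count w all_edges (real n)) \<longlonglongrightarrow> 1"
    have "{e\<in>all_edges. \<omega> \<in> {\<omega>\<in>space M. E n \<omega> \<inter> {e} \<noteq> {}}} = E n \<omega>" for n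
      using E_subset[OF *(1)] *(1) by auto
    then show "(\<lambda>n. real (card (E n \<omega>)) / expected_count w all_edges (real n)) \<longlonglongrightarrow> 1"
      using *(2) by simp
  qed
qed

end

text \<open>
  A vertex is present when its star meets the edge set. For distinct \<open>i\<close> and \<open>j\<close> let \<open>U\<close> be the union of
  the two stars. The correction event is that \<open>{i, j}\<close> is the only edge of \<open>U\<close> that is present, that is,
  an isolated edge. Its probability is the probability of avoiding all of \<open>U\<close> except \<open>{i, j}\<close>, minus the
  probability of avoiding \<open>U\<close>. With this value, the bound on the covariance at time \<open>n\<close> reads
  \<open>2 * g (a + b - x) ^ n \<le> (g a * g b) ^ n + g (a + b - 2 * x) ^ n\<close>; it follows from \<open>g_overlap\<close> because
  powers are monotone and midpoint convex.
\<close>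
sublocale growing_edge_set \<subseteq> vertices: growing_count M "{1..}"
  "\<lambda>n i. {\<omega>\<in>space M. E n \<omega> \<inter> star i \<noteq> {}}"
  "\<lambda>n i j. {\<omega>\<in>space M. E n \<omega> \<inter> (star i \<union> star j) = {{i, j}}}"
  "\<lambda>i. g (infsum w (star i))" "\<lambda>i. infsum w (star i)"
proof
  have le: "infsum w (star i) \<le> infsum w all_edges" for i
    by (intro weight_mono star_subset order_refl)
  show "countable {1::nat..}" by simp
  fix i :: nat and n assume i: "i \<in> {1..}"
  show "{\<omega>\<in>space M. E n \<omega> \<inter> star i \<noteq> {}} \<in> events" by (intro meets_event star_subset)
  show "prob {\<omega>\<in>space M. E n \<omega> \<inter> star i \<noteq> {}} = 1 - g (infsum w (star i)) ^ n"
    by (intro prob_meets star_subset)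
  show nn: "0 \<le> infsum w (star i)" by (intro weight_nonneg star_subset)
  then show "0 \<le> g (infsum w (star i))" "1 - infsum w (star i) \<le> g (infsum w (star i))"
    "g (infsum w (star i)) \<le> exp (- infsum w (star i))"
    by (intro g_nonneg g_lower g_upper le; assumption)+
  show "disjoint_family_on (\<lambda>j. {\<omega>\<in>space M. E n \<omega> \<inter> (star i \<union> star j) = {{i, j}}}) {1..}"
  proof (unfold disjoint_family_on_def, intro ballI impI equals0I)
    fix j k \<omega> assume "j \<noteq> k" and \<omega>: "\<omega> \<in> {\<omega>\<in>space M. E n \<omega> \<inter> (star i \<union> star j) = {{i, j}}} \<inter>
      {\<omega>\<in>space M. E n \<omega> \<inter> (star i \<union> star k) = {{i, k}}}"
    then have "{i, j} \<in> E n \<omega> \<inter> (star i \<union> star j)" by simp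
    then have "{i, j} \<in> E n \<omega> \<inter> (star i \<union> star k)" by (simp add: star_def)
    also have "\<dots> = {{i, k}}" using \<omega> by simp
    finally show False using \<open>j \<noteq> k\<close> by (auto simp: doubleton_eq_iff)
  qed
  fix j :: nat assume j: "j \<in> {1..}"
  let ?U = "star i \<union> star j"
  have U: "?U \<subseteq> all_edges" using star_subset by auto
  have D_eq: "{\<omega>\<in>space M. E n \<omega> \<inter> ?U = {{i, j}}} = avoid n (?U - {{i, j}}) - avoid n ?U" by blast
  have D_event: "{\<omega>\<in>space M. E n \<omega> \<inter> ?U = {{i, j}}} \<in> events"
    unfolding D_eq using U by (intro sets.Diff avoid_event) auto
  moreover have "{\<omega>\<in>space M. E n \<omega> \<inter> ?U = {{i, j}}} \<subseteq> {\<omega>\<in>space M. E n \<omega> \<inter> star i \<noteq> {}}"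
    unfolding star_def by blast
  ultimately show "{\<omega>\<in>space M. E n \<omega> \<inter> ?U = {{i, j}}} \<in> events \<and>
      {\<omega>\<in>space M. E n \<omega> \<inter> ?U = {{i, j}}} \<subseteq> {\<omega>\<in>space M. E n \<omega> \<inter> star i \<noteq> {}}" ..
  assume "i \<noteq> j"
  define a b x where "a = infsum w (star i)" and "b = infsum w (star j)" and "x = infsum w (star i \<inter> star j)"
  have x: "0 \<le> x" "x \<le> a" "x \<le> b" "0 \<le> a" "0 \<le> b"
    unfolding x_def a_def b_def using star_subset by (auto intro!: weight_nonneg weight_mono)
  have wU: "infsum w ?U = a + b - x"
    unfolding a_def b_def x_def using star_subset
    by (intro infsum_Un_Int summable_subset) auto
  then have U_le: "a + b - x \<le> infsum w all_edges" using weight_mono[OF U] by simp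
  \<comment> \<open>The two stars meet at most in the edge \<open>{i, j}\<close>, which is therefore what \<open>x\<close> weighs.\<close>
  have "infsum w (?U - star i \<inter> star j) = infsum w ?U - x"
    unfolding x_def using U star_subset by (intro infsum_Diff summable_subset) auto
  moreover have "?U - {{i, j}} = ?U - star i \<inter> star j"
    using U by (auto simp: star_Int_star[OF \<open>i \<noteq> j\<close>])
  ultimately have wV: "infsum w (?U - {{i, j}}) = a + b - 2 * x" using wU by simp
  have "prob {\<omega>\<in>space M. E n \<omega> \<inter> ?U = {{i, j}}} = prob (avoid n (?U - {{i, j}})) - prob (avoid n ?U)"
    unfolding D_eq using U by (intro finite_measure_Diff avoid_event) auto
  moreover have "2 * g (a + b - x) ^ n \<le> (g a * g b) ^ n + g (a + b - 2 * x) ^ n"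
    using x U_le g_overlap[OF x(1-3) U_le] le[of i] le[of j] g_nonneg
    by (intro power_midpoint_convex mult_nonneg_nonneg) (auto simp: a_def b_def)
  ultimately have "prob (avoid n ?U) \<le> prob (avoid n (star i)) * prob (avoid n (star j)) +
      prob {\<omega>\<in>space M. E n \<omega> \<inter> ?U = {{i, j}}}"
    using star_subset prob_avoid[OF U, of n] prob_avoid[OF order_trans[OF Diff_subset[of _ "{{i, j}}"] U], of n] wU wV
      prob_avoid[of "star i" n] prob_avoid[of "star j" n]
    by (simp add: power_mult_distrib a_def[symmetric] b_def[symmetric])
  then show "prob ({\<omega>\<in>space M. E n \<omega> \<inter> star i \<noteq> {}} \<inter> {\<omega>\<in>space M. E n \<omega> \<inter> star j \<noteq> {}}) \<le>
    prob {\<omega>\<in>space M. E n \<omega> \<inter> star i \<noteq> {}} * prob {\<omega>\<in>space M. E n \<omega> \<inter> star j \<noteq> {}} +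
      prob {\<omega>\<in>space M. E n \<omega> \<inter> ?U = {{i, j}}}"
    by (intro prob_meets_Int_le star_subset)
next
  show "(\<lambda>i. infsum w (star i)) summable_on {1..}"
    by (intro summable_star_weights w_summable w_nonneg)
  show "AE \<omega> in M. \<forall>i\<in>{1..}. \<forall>n. \<omega> \<in> {\<omega>\<in>space M. E n \<omega> \<inter> star i \<noteq> {}} \<longrightarrow>
      \<omega> \<in> {\<omega>\<in>space M. E (Suc n) \<omega> \<inter> star i \<noteq> {}}"
    using AE_E_mono by eventually_elim blast
qed

lemma (in growing_edge_set) AE_num_vertices_ratio:
  "AE \<omega> in M. (\<lambda>n. real (card (\<Union>(E n \<omega>))) /
     expected_count (\<lambda>i. infsum w (star i)) {1..} (real n)) \<longlonglongrightarrow> 1"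
proof -
  obtain e where e: "e \<in> all_edges" "0 < w e" by (rule obtain_positive_edge)
  then obtain i j where i: "e = {i, j}" "1 \<le> i" by (auto elim!: mem_all_edgesE)
  have "infsum w {e} \<le> infsum w (star i)"
    using e i star_subset by (intro weight_mono) (auto simp: star_def)
  then have "0 < infsum w (star i)" using e by simp
  with i have "AE \<omega> in M. (\<lambda>n. vertices.count n \<omega> /
     expected_count (\<lambda>i. infsum w (star i)) {1..} (real n)) \<longlonglongrightarrow> 1"
    by (intro vertices.AE_ratio_tendsto_1[of i]) auto
  then show ?thesis
  proof (rule AE_mp, intro AE_I2 impI)
    fix \<omega> assume *: "\<omega> \<in> space M" "(\<lambda>n. vertices.count n \<omega> /
     expected_count (\<lambda>i. infsum w (star i)) {1..} (real n)) \<longlonglongrightarrow> 1"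
    have "{i\<in>{1..}. \<omega> \<in> {\<omega>\<in>space M. E n \<omega> \<inter> star i \<noteq> {}}} = \<Union>(E n \<omega>)" for n
      using E_subset[OF *(1), of n] *(1) by (fastforce simp: star_def elim: mem_all_edgesE)
    then show "(\<lambda>n. real (card (\<Union>(E n \<omega>))) /
     expected_count (\<lambda>i. infsum w (star i)) {1..} (real n)) \<longlonglongrightarrow> 1"
      using *(2) by simp
  qed
qed

section \<open>Edge weights and vertex rates\<close>

text \<open>
  Indexing the weights by edges instead of ordered pairs makes the weight of a set of edges a plain
  sum over that set.
\<close>
definition edge_weight :: "(nat \<Rightarrow> nat \<Rightarrow> real) \<Rightarrow> nat set \<Rightarrow> real" where
  "edge_weight \<mu> e = \<mu> (Min e) (Max e)"

lemma edge_weight_doubleton: "i < j \<Longrightarrow> edge_weight \<mu> {i, j} = \<mu> i j"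
  by (simp add: edge_weight_def)

lemma bij_betw_pairs_edges: "bij_betw (\<lambda>(i, j). {i, j}) index_pairs all_edges"
  unfolding bij_betw_def all_edges_def
  by (auto simp: inj_on_def index_pairs_def doubleton_eq_iff)

lemma
  fixes h :: "real \<Rightarrow> real"
  shows summable_on_edges_iff: "(\<lambda>e. h (edge_weight \<mu> e)) summable_on all_edges \<longleftrightarrow>
      (\<lambda>(i, j). h (\<mu> i j)) summable_on index_pairs"
    and infsum_edges: "(\<Sum>\<^sub>\<infinity>e\<in>all_edges. h (edge_weight \<mu> e)) = (\<Sum>\<^sub>\<infinity>(i, j)\<in>index_pairs. h (\<mu> i j))"
proof -
  have eq: "h (edge_weight \<mu> (case p of (i, j) \<Rightarrow> {i, j})) = (case p of (i, j) \<Rightarrow> h (\<mu> i j))"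
    if "p \<in> index_pairs" for p
    using that by (auto simp: index_pairs_def edge_weight_doubleton)
  show "(\<lambda>e. h (edge_weight \<mu> e)) summable_on all_edges \<longleftrightarrow> (\<lambda>(i, j). h (\<mu> i j)) summable_on index_pairs"
    using summable_on_reindex_bij_betw[OF bij_betw_pairs_edges, of "\<lambda>e. h (edge_weight \<mu> e)"]
      summable_on_cong[OF eq, of index_pairs "\<lambda>x. x"] by simp
  show "(\<Sum>\<^sub>\<infinity>e\<in>all_edges. h (edge_weight \<mu> e)) = (\<Sum>\<^sub>\<infinity>(i, j)\<in>index_pairs. h (\<mu> i j))"
    using infsum_reindex_bij_betw[OF bij_betw_pairs_edges, of "\<lambda>e. h (edge_weight \<mu> e)"]
      infsum_cong[OF eq, of index_pairs "\<lambda>x. x"] by simp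
qed

context
  fixes \<mu> :: "nat \<Rightarrow> nat \<Rightarrow> real"
  assumes weights: "edge_weights \<mu>"
begin

lemma \<mu>_sym: "1 \<le> i \<Longrightarrow> 1 \<le> j \<Longrightarrow> \<mu> i j = \<mu> j i"
  and \<mu>_nonneg: "1 \<le> i \<Longrightarrow> 1 \<le> j \<Longrightarrow> 0 \<le> \<mu> i j"
  and \<mu>_diag: "1 \<le> i \<Longrightarrow> \<mu> i i = 0"
  and total_mass_pos: "0 < total_mass \<mu>"
  using weights by (auto simp: edge_weights_def)

lemma edge_weight_nonneg: "e \<in> all_edges \<Longrightarrow> 0 \<le> edge_weight \<mu> e"
  by (erule mem_all_edgesE) (simp add: edge_weight_doubleton \<mu>_nonneg)

lemma edge_weight_eq:
  assumes "1 \<le> i" "1 \<le> j" "i \<noteq> j"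
  shows "{i, j} \<in> all_edges" "edge_weight \<mu> {i, j} = \<mu> i j"
proof -
  show "edge_weight \<mu> {i, j} = \<mu> i j"
    using assms \<mu>_sym[of i j] edge_weight_doubleton[of i j \<mu>] edge_weight_doubleton[of j i \<mu>]
    by (cases i j rule: linorder_cases) (auto simp: insert_commute)
  show "{i, j} \<in> all_edges"
    using assms by (cases "i < j") (force simp: all_edges_def index_pairs_def)+
qed

lemma edge_weight_summable: "edge_weight \<mu> summable_on all_edges"
  using weights summable_on_edges_iff[of "\<lambda>x. x" \<mu>] by (simp add: edge_weights_def)

lemma infsum_edge_weight: "infsum (edge_weight \<mu>) all_edges = total_mass \<mu>"
  using infsum_edges[of "\<lambda>x. x" \<mu>] by (simp add: total_mass_def)

lemma infsum_star:
  assumes "1 \<le> i"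
  shows "infsum (edge_weight \<mu>) (star i) = vertex_rate \<mu> i"
proof -
  have "bij_betw (\<lambda>j. {i, j}) ({1..} - {i}) (star i)"
  proof (rule bij_betwI')
    show "\<exists>j\<in>{1..} - {i}. e = {i, j}" if "e \<in> star i" for e
      using that by (auto simp: star_def elim!: mem_all_edgesE)
  qed (use assms edge_weight_eq in \<open>auto simp: doubleton_eq_iff star_def\<close>)
  then have "infsum (edge_weight \<mu>) (star i) = (\<Sum>\<^sub>\<infinity>j\<in>{1..} - {i}. edge_weight \<mu> {i, j})"
    by (rule infsum_reindex_bij_betw[symmetric])
  also have "\<dots> = vertex_rate \<mu> i"
    unfolding vertex_rate_def using assms edge_weight_eq \<mu>_diag
    by (intro infsum_cong_neutral) auto
  finally show ?thesis .
qed

lemma vertex_rate_nonneg: "1 \<le> i \<Longrightarrow> 0 \<le> vertex_rate \<mu> i"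
  unfolding vertex_rate_def using \<mu>_nonneg by (intro infsum_nonneg) auto

lemma vertex_rate_summable: "vertex_rate \<mu> summable_on {1..}"
proof -
  have "(\<lambda>i. infsum (edge_weight \<mu>) (star i)) summable_on {1..}"
    by (intro summable_star_weights edge_weight_summable edge_weight_nonneg)
  then show ?thesis by (rule summable_on_cong[THEN iffD1, rotated]) (simp add: infsum_star)
qed

lemma vertex_rate_pos:
  assumes "1 \<le> i" "1 \<le> j" "0 < \<mu> i j"
  shows "0 < vertex_rate \<mu> i"
proof -
  have ij: "i \<noteq> j" using assms \<mu>_diag by auto
  have "0 < infsum (edge_weight \<mu>) {{i, j}}" using assms edge_weight_eq ij by simp
  also have "\<dots> \<le> infsum (edge_weight \<mu>) (star i)"
    using edge_weight_eq[OF assms(1,2) ij] edge_weight_nonneg star_subset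
    by (intro infsum_mono2 summable_on_subset_banach[OF edge_weight_summable]) (auto simp: star_def)
  finally show ?thesis using assms infsum_star by simp
qed

text \<open>
  Finitely many vertices of positive rate, or finitely many edges of positive weight, would involve
  only finitely many pairs.
\<close>
lemma infinite_positive_rates:
  assumes inf: "infinite {(i, j). 1 \<le> i \<and> 1 \<le> j \<and> \<mu> i j > 0}"
  shows "infinite {i\<in>{1..}. 0 < vertex_rate \<mu> i}" (is "infinite ?V")
    and "infinite {e\<in>all_edges. 0 < edge_weight \<mu> e}" (is "infinite ?E")
proof -
  let ?P = "{(i, j). 1 \<le> i \<and> 1 \<le> j \<and> \<mu> i j > 0}"
  have "?P \<subseteq> ?V \<times> ?V" using vertex_rate_pos \<mu>_sym by fastforce
  then show "infinite ?V" using inf finite_subset finite_cartesian_product by blast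
  have "?P \<subseteq> \<Union>?E \<times> \<Union>?E"
  proof safe
    fix i j assume ij: "1 \<le> i" "1 \<le> j" "0 < \<mu> i j"
    then have "i \<noteq> j" using \<mu>_diag by auto
    then have "{i, j} \<in> ?E" using ij edge_weight_eq by simp
    then show "i \<in> \<Union>?E" "j \<in> \<Union>?E" by blast+
  qed
  moreover have "finite (\<Union>?E \<times> \<Union>?E)" if "finite ?E"
    using that by (intro finite_cartesian_product finite_Union) (auto elim!: mem_all_edgesE)
  ultimately show "infinite ?E" using inf finite_subset by blast
qed

text \<open>
  Each edge arises from two ordered pairs, and \<open>h 0 = 0\<close> removes the diagonal.
\<close>
lemma infsum_ordered_pairs:
  fixes h :: "real \<Rightarrow> real"
  assumes "h 0 = 0" "(\<lambda>e. h (edge_weight \<mu> e)) summable_on all_edges"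
  shows "(\<Sum>\<^sub>\<infinity>(i, j)\<in>{1..} \<times> {1..}. h (\<mu> i j)) = 2 * (\<Sum>\<^sub>\<infinity>e\<in>all_edges. h (edge_weight \<mu> e))"
proof -
  let ?f = "\<lambda>(i, j). h (\<mu> i j)"
  let ?Q = "prod.swap ` index_pairs"
  have inj: "inj_on prod.swap index_pairs" by (auto simp: inj_on_def)
  have s1: "?f summable_on index_pairs" using assms(2) summable_on_edges_iff by blast
  have eq: "?f (prod.swap p) = ?f p" if "p \<in> index_pairs" for p
    using that \<mu>_sym[of "snd p" "fst p"] by (auto simp: index_pairs_def)
  have "(?f \<circ> prod.swap) summable_on index_pairs"
    using s1 by (rule summable_on_cong[THEN iffD1, rotated]) (simp only: eq comp_apply)
  then have s2: "?f summable_on ?Q" using summable_on_reindex[OF inj] by blast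
  have "infsum ?f ?Q = infsum (?f \<circ> prod.swap) index_pairs" by (rule infsum_reindex[OF inj])
  also have "\<dots> = infsum ?f index_pairs" by (rule infsum_cong) (simp only: eq comp_apply)
  finally have i2: "infsum ?f ?Q = infsum ?f index_pairs" .
  have "infsum ?f ({1..} \<times> {1..}) = infsum ?f (index_pairs \<union> ?Q)"
  proof (rule infsum_cong_neutral)
    show "?f p = 0" if "p \<in> {1..} \<times> {1..} - (index_pairs \<union> ?Q)" for p
    proof -
      obtain i j where p: "p = (i, j)" by (cases p)
      have "1 \<le> i" "\<not> i < j" using that by (auto simp: p index_pairs_def)
      moreover have "\<not> j < i"
      proof
        assume "j < i"
        then have "(j, i) \<in> index_pairs" using that by (auto simp: p index_pairs_def)
        then have "p \<in> ?Q" using imageI[of "(j, i)" index_pairs prod.swap] by (simp add: p)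
        then show False using that by blast
      qed
      ultimately show ?thesis using \<mu>_diag[of i] assms(1) by (simp add: p)
    qed
  qed (auto simp: index_pairs_def)
  also have "\<dots> = infsum ?f index_pairs + infsum ?f ?Q"
    by (intro infsum_Un_disjoint s1 s2) (auto simp: index_pairs_def)
  finally show ?thesis using i2 infsum_edges by simp
qed

end

section \<open>Independent draws of edges\<close>

lemma prob_iid_edge_in:
  assumes \<mu>: "edge_weights \<mu>" and M: "prob_space M" and Y: "prob_space.iid_edges M \<mu> Y"
    and k: "1 \<le> k" and S: "S \<subseteq> all_edges"
  shows "Y k \<in> M \<rightarrow>\<^sub>M count_space all_edges"
    and "measure M (Y k -` S \<inter> space M) = (\<Sum>\<^sub>\<infinity>e\<in>S. edge_weight \<mu> e / total_mass \<mu>)"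
proof -
  interpret prob_space M by fact
  show meas: "Y k \<in> M \<rightarrow>\<^sub>M count_space all_edges"
    using Y k by (auto simp: iid_edges_def indep_vars_def)
  have S_countable: "countable S" using S countable_all_edges countable_subset by blast
  have Y_e: "prob (Y k -` {e} \<inter> space M) = edge_weight \<mu> e / total_mass \<mu>" if e: "e \<in> all_edges" for e
  proof -
    obtain i j where ij: "e = {i, j}" "1 \<le> i" "i < j" using e by (rule mem_all_edgesE)
    have "prob {\<omega> \<in> space M. Y k \<omega> = {i, j}} = \<mu> i j / total_mass \<mu>"
      using Y k ij unfolding iid_edges_def index_pairs_def by auto
    moreover have "Y k -` {e} \<inter> space M = {\<omega> \<in> space M. Y k \<omega> = {i, j}}" using ij by auto
    ultimately show ?thesis using ij by (simp add: edge_weight_doubleton)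
  qed
  have summ: "(\<lambda>e. edge_weight \<mu> e / total_mass \<mu>) summable_on S"
    unfolding divide_inverse
    by (intro summable_on_cmult_left summable_on_subset_banach[OF edge_weight_summable[OF \<mu>] S])
  have "emeasure M (Y k -` S \<inter> space M) = emeasure M (\<Union>e\<in>S. Y k -` {e} \<inter> space M)"
    by (intro arg_cong[where f = "emeasure M"]) auto
  also have "\<dots> = (\<integral>\<^sup>+e. emeasure M (Y k -` {e} \<inter> space M) \<partial>count_space S)"
    using S S_countable measurable_sets[OF meas]
    by (intro emeasure_UN_countable) (auto simp: disjoint_family_on_def)
  also have "\<dots> = (\<integral>\<^sup>+e. ennreal (edge_weight \<mu> e / total_mass \<mu>) \<partial>count_space S)"
    using S Y_e by (intro nn_integral_cong) (auto simp: emeasure_eq_measure)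
  also have "\<dots> = ennreal (\<Sum>\<^sub>\<infinity>e\<in>S. edge_weight \<mu> e / total_mass \<mu>)"
    using S edge_weight_nonneg[OF \<mu>] total_mass_pos[OF \<mu>] summ
    by (intro nn_integral_count_space_eq_infsum) auto
  finally have "ennreal (prob (Y k -` S \<inter> space M)) =
      ennreal (\<Sum>\<^sub>\<infinity>e\<in>S. edge_weight \<mu> e / total_mass \<mu>)"
    by (simp add: emeasure_eq_measure)
  moreover have "0 \<le> (\<Sum>\<^sub>\<infinity>e\<in>S. edge_weight \<mu> e / total_mass \<mu>)"
    using S edge_weight_nonneg[OF \<mu>] total_mass_pos[OF \<mu>] by (intro infsum_nonneg) auto
  ultimately show "prob (Y k -` S \<inter> space M) = (\<Sum>\<^sub>\<infinity>e\<in>S. edge_weight \<mu> e / total_mass \<mu>)"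
    by simp
qed

text \<open>
  A single draw avoids a set of edges of normalised weight \<open>x\<close> with probability \<open>1 - x\<close>, and the draws
  are independent. For \<open>g x = 1 - x\<close>, the differences of the two sides of \<open>g_add\<close> and \<open>g_overlap\<close> are
  the products \<open>x * y\<close> and \<open>a * b\<close>.
\<close>
lemma iid_growing_edge_set:
  assumes \<mu>: "edge_weights \<mu>" and M: "prob_space M" and Y: "prob_space.iid_edges M \<mu> Y"
  shows "growing_edge_set M (\<lambda>e. edge_weight \<mu> e / total_mass \<mu>) (\<lambda>x. 1 - x)
    (\<lambda>m \<omega>. (\<lambda>k. Y k \<omega>) ` {1..m})"
proof -
  interpret prob_space M by fact
  let ?w = "\<lambda>e. edge_weight \<mu> e / total_mass \<mu>"
  have W: "0 < total_mass \<mu>" by (rule total_mass_pos[OF \<mu>])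
  have total: "infsum ?w all_edges = 1"
    unfolding divide_inverse using W infsum_edge_weight[OF \<mu>] by (simp add: infsum_cmult_left')
  have summ: "?w summable_on all_edges"
    unfolding divide_inverse by (intro summable_on_cmult_left edge_weight_summable[OF \<mu>])
  note Y_meas = prob_iid_edge_in(1)[OF \<mu> M Y _ order_refl]
  have Y_in: "Y k \<omega> \<in> all_edges" if "1 \<le> k" "\<omega> \<in> space M" for k \<omega>
    using measurable_space[OF Y_meas[OF that(1)] that(2)] by simp
  have avoid: "{\<omega>\<in>space M. (\<lambda>k. Y k \<omega>) ` {1..m} \<inter> S = {}} \<in> events \<and>
      prob {\<omega>\<in>space M. (\<lambda>k. Y k \<omega>) ` {1..m} \<inter> S = {}} = (1 - infsum ?w S) ^ m"
    if S: "S \<subseteq> all_edges" for S m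
  proof (cases "m = 0")
    case True
    then show ?thesis by (simp add: prob_space)
  next
    case False
    have eq: "{\<omega>\<in>space M. (\<lambda>k. Y k \<omega>) ` {1..m} \<inter> S = {}} =
        (\<Inter>k\<in>{1..m}. Y k -` (all_edges - S) \<inter> space M)"
    proof (intro set_eqI iffI)
      fix \<omega> assume \<omega>: "\<omega> \<in> (\<Inter>k\<in>{1..m}. Y k -` (all_edges - S) \<inter> space M)"
      have "1 \<in> {1..m}" using False by simp
      with \<omega> have "\<omega> \<in> Y 1 -` (all_edges - S) \<inter> space M" by (rule INT_D)
      with \<omega> show "\<omega> \<in> {\<omega>\<in>space M. (\<lambda>k. Y k \<omega>) ` {1..m} \<inter> S = {}}" by auto
    qed (use Y_in in auto)
    have "prob (Y k -` (all_edges - S) \<inter> space M) = 1 - infsum ?w S" if "1 \<le> k" for k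
    proof -
      have "prob (Y k -` (all_edges - S) \<inter> space M) = infsum ?w (all_edges - S)"
        using prob_iid_edge_in(2)[OF \<mu> M Y that] by simp
      also have "\<dots> = 1 - infsum ?w S"
        using infsum_Diff[OF summ summable_on_subset_banach[OF summ S] S] total by simp
      finally show ?thesis .
    qed
    moreover have "prob (\<Inter>k\<in>{1..m}. Y k -` (all_edges - S) \<inter> space M) =
        (\<Prod>k\<in>{1..m}. prob (Y k -` (all_edges - S) \<inter> space M))"
      using Y False unfolding iid_edges_def by (intro indep_varsD[of _ Y "{1..}"]) auto
    moreover have "(\<Inter>k\<in>{1..m}. Y k -` (all_edges - S) \<inter> space M) \<in> events"
      using False by (intro sets.finite_INT measurable_sets[OF Y_meas]) auto
    ultimately show ?thesis unfolding eq by simp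
  qed
  show ?thesis
  proof
    show "0 \<le> ?w e" if "e \<in> all_edges" for e
      using edge_weight_nonneg[OF \<mu> that] W by simp
    show "(\<lambda>k. Y k \<omega>) ` {1..m} \<subseteq> all_edges" if "\<omega> \<in> space M" for \<omega> m
      using Y_in that by auto
    show "1 - x \<le> exp (- x)" for x :: real
      using exp_ge_add_one_self[of "- x"] by simp
    show "{\<omega>\<in>space M. (\<lambda>k. Y k \<omega>) ` {1..m} \<inter> S = {}} \<in> events"
      "prob {\<omega>\<in>space M. (\<lambda>k. Y k \<omega>) ` {1..m} \<inter> S = {}} = (1 - infsum ?w S) ^ m"
      if "S \<subseteq> all_edges" for S m
      using avoid[OF that] by auto
    show "0 \<le> 1 - x" if "x \<le> infsum ?w all_edges" for x
      using that unfolding total by simp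
    show "1 - (x + y) \<le> (1 - x) * (1 - y)" if "0 \<le> x" "0 \<le> y" for x y :: real
      using mult_nonneg_nonneg[OF that] by (simp add: algebra_simps)
    show "2 * (1 - (a + b - x)) \<le> (1 - a) * (1 - b) + (1 - (a + b - 2 * x))"
      if "0 \<le> x" "x \<le> a" "x \<le> b" for a b x :: real
      using mult_nonneg_nonneg[of a b] that by (simp add: algebra_simps)
    show "AE \<omega> in M. \<forall>m. (\<lambda>k. Y k \<omega>) ` {1..m} \<subseteq> (\<lambda>k. Y k \<omega>) ` {1..Suc m}"
      by (intro AE_I2 allI image_mono) auto
    show "0 < infsum ?w all_edges" unfolding total by simp
    show "?w summable_on all_edges" by (rule summ)
  qed simp
qed

section \<open>Poisson arrivals of edges\<close>

definition arrived_edges :: "(nat \<Rightarrow> nat \<Rightarrow> real \<Rightarrow> 'a \<Rightarrow> nat) \<Rightarrow> real \<Rightarrow> 'a \<Rightarrow> nat set set" where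
  "arrived_edges N t \<omega> = {{i, j} | i j. (i, j) \<in> index_pairs \<and> N i j t \<omega> \<ge> 1}"

lemma arrived_edges_subset: "arrived_edges N t \<omega> \<subseteq> all_edges"
  by (auto simp: arrived_edges_def all_edges_def)

lemma poisson_graph_eq: "poisson_graph N t \<omega> = (\<Union>(arrived_edges N t \<omega>), arrived_edges N t \<omega>)"
  by (simp add: poisson_graph_def graph_of_edges_def arrived_edges_def)

lemma countable_index_pairs: "countable index_pairs"
  by (rule countable_subset[OF subset_UNIV]) simp

locale poisson_edges = prob_space +
  fixes \<mu> :: "nat \<Rightarrow> nat \<Rightarrow> real" and N :: "nat \<Rightarrow> nat \<Rightarrow> real \<Rightarrow> 'a \<Rightarrow> nat"
  assumes weights: "edge_weights \<mu>" and arrivals: "poisson_arrivals \<mu> N"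
begin

lemma process: "(i, j) \<in> index_pairs \<Longrightarrow> poisson_process (\<mu> i j) (N i j)"
  using arrivals by (auto simp: poisson_arrivals_def)

lemma N_measurable: "(i, j) \<in> index_pairs \<Longrightarrow> 0 \<le> t \<Longrightarrow> N i j t \<in> M \<rightarrow>\<^sub>M count_space UNIV"
  using process by (auto simp: poisson_process_def)

lemma AE_paths: "AE \<omega> in M. \<forall>(i, j)\<in>index_pairs. N i j 0 \<omega> = 0 \<and> mono_on {0..} (\<lambda>t. N i j t \<omega>)"
proof -
  have "AE \<omega> in M. N i j 0 \<omega> = 0 \<and> mono_on {0..} (\<lambda>t. N i j t \<omega>)" if "(i, j) \<in> index_pairs" for i j
  proof -
    have "AE \<omega> in M. N i j 0 \<omega> = 0 \<and> mono_on {0..} (\<lambda>t. N i j t \<omega>) \<and>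
        (\<forall>t\<ge>0. continuous (at_right t) (\<lambda>s. real (N i j s \<omega>)))"
      using process[OF that] unfolding poisson_process_def by blast
    then show ?thesis by eventually_elim auto
  qed
  then show ?thesis
    unfolding AE_ball_countable[OF countable_index_pairs] by auto
qed

abbreviation rate :: "nat \<times> nat \<Rightarrow> real" where
  "rate p \<equiv> \<mu> (fst p) (snd p)"

definition no_arrival :: "real \<Rightarrow> (nat \<times> nat) set \<Rightarrow> 'a set" where
  "no_arrival t P = {\<omega>\<in>space M. \<forall>p\<in>P. N (fst p) (snd p) t \<omega> = 0}"

lemma no_arrival_event:
  assumes "P \<subseteq> index_pairs" "0 \<le> t"
  shows "no_arrival t P \<in> events"
proof -
  have "{\<omega>\<in>space M. N (fst p) (snd p) t \<omega> = 0} \<in> events" if "p \<in> P" for p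
  proof -
    have [measurable]: "N (fst p) (snd p) t \<in> M \<rightarrow>\<^sub>M count_space UNIV"
      using N_measurable[of "fst p" "snd p" t] assms that by auto
    show ?thesis by measurable
  qed
  then show ?thesis
    unfolding no_arrival_def by (intro sets.sets_Collect_countable_All') auto
qed

text \<open>
  The law of a Poisson process is given through its increments; since it almost surely starts at \<open>0\<close>,
  its value at \<open>t > 0\<close> is almost surely the increment from \<open>0\<close> to \<open>t\<close>.
\<close>
lemma prob_no_arrival_single:
  assumes p: "p \<in> index_pairs" and t: "0 \<le> t"
  shows "prob (no_arrival t {p}) = exp (- (rate p * t))"
proof -
  obtain i j where ij: "p = (i, j)" by (cases p)
  have zero: "AE \<omega> in M. N i j 0 \<omega> = 0" using AE_paths by eventually_elim (use p ij in auto)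
  have event: "no_arrival t {p} \<in> events" using p t by (intro no_arrival_event) auto
  show ?thesis
  proof (cases "t = 0")
    case True
    have "AE \<omega> in M. \<omega> \<in> no_arrival t {p}"
      using zero AE_space by eventually_elim (simp add: no_arrival_def True ij)
    then have "prob (no_arrival t {p}) = 1" using event by (simp add: prob_eq_1)
    then show ?thesis using True by simp
  next
    case False
    let ?D = "{\<omega>\<in>space M. N i j t \<omega> - N i j 0 \<omega> = 0}"
    have [measurable]: "N i j t \<in> M \<rightarrow>\<^sub>M count_space UNIV" "N i j 0 \<in> M \<rightarrow>\<^sub>M count_space UNIV"
      using N_measurable p t ij by auto
    have D: "?D \<in> events" by measurable
    have "AE \<omega> in M. \<omega> \<in> no_arrival t {p} \<longleftrightarrow> \<omega> \<in> ?D"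
      using zero by eventually_elim (simp add: no_arrival_def ij)
    then have "prob (no_arrival t {p}) = prob ?D"
      using event D by (rule measure_eq_AE)
    also have "\<dots> = (\<mu> i j * (t - 0)) ^ 0 / fact 0 * exp (- (\<mu> i j * (t - 0)))"
    proof -
      have "0 \<le> (0::real) \<and> 0 < t" using t False by simp
      then show ?thesis using process[of i j] p ij unfolding poisson_process_def by blast
    qed
    finally show ?thesis using ij by simp
  qed
qed

text \<open>
  Independence of the sample paths is applied to the event that a path vanishes at time \<open>t\<close>.
\<close>
lemma prob_no_arrival_finite:
  assumes P: "P \<subseteq> index_pairs" "finite P" and t: "0 \<le> t"
  shows "prob (no_arrival t P) = exp (- (sum rate P * t))"
proof (cases "P = {}")
  case True
  then show ?thesis by (simp add: no_arrival_def prob_space)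
next
  case False
  let ?X = "\<lambda>(i, j) \<omega>. \<lambda>t\<in>{0..}. N i j t \<omega>"
  let ?B = "(\<lambda>f. f t) -` {0} \<inter> space (PiM {0::real..} (\<lambda>_. count_space (UNIV :: nat set)))"
  have B: "?B \<in> sets (PiM {0..} (\<lambda>_. count_space UNIV))"
    using t by (intro measurable_sets[OF measurable_component_singleton]) auto
  have single: "?X p -` ?B \<inter> space M = no_arrival t {p}" for p
    using t by (cases p) (auto simp: no_arrival_def space_PiM)
  have "no_arrival t P = (\<Inter>p\<in>P. no_arrival t {p})"
    using False by (auto simp: no_arrival_def)
  also have "prob \<dots> = (\<Prod>p\<in>P. prob (no_arrival t {p}))"
  proof -
    have "indep_vars (\<lambda>_. PiM {0..} (\<lambda>_. count_space UNIV)) ?X index_pairs"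
      using arrivals by (simp add: poisson_arrivals_def)
    then have "prob (\<Inter>p\<in>P. ?X p -` ?B \<inter> space M) = (\<Prod>p\<in>P. prob (?X p -` ?B \<inter> space M))"
      using P False B by (intro indep_varsD)
    then show ?thesis unfolding single .
  qed
  also have "\<dots> = (\<Prod>p\<in>P. exp (- (rate p * t)))"
    using P t by (intro prod.cong prob_no_arrival_single) auto
  also have "\<dots> = exp (- (sum rate P * t))"
    using P by (simp add: exp_sum[symmetric] sum_negf sum_distrib_right)
  finally show ?thesis .
qed

text \<open>
  Countable sets of pairs are exhausted by finite ones, and both sides are continuous along the
  exhaustion.
\<close>
lemma prob_no_arrival:
  assumes P: "P \<subseteq> index_pairs" and summ: "rate summable_on P" and t: "0 \<le> t"
  shows "prob (no_arrival t P) = exp (- (infsum rate P * t))"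
proof -
  define F where "F n = {p\<in>P. to_nat p < n}" for n
  have F: "finite (F n)" "F n \<subseteq> P" for n
  proof -
    have "F n \<subseteq> to_nat -` {..<n}" by (auto simp: F_def)
    then show "finite (F n)" by (rule finite_subset) (intro finite_vimageI inj_to_nat finite_lessThan)
  qed (auto simp: F_def)
  have "(\<lambda>n. prob (no_arrival t (F n))) \<longlonglongrightarrow> prob (\<Inter>n. no_arrival t (F n))"
  proof (rule finite_Lim_measure_decseq)
    have "no_arrival t (F n) \<in> events" for n
      using F(2)[of n] P t by (intro no_arrival_event) auto
    then show "range (\<lambda>n. no_arrival t (F n)) \<subseteq> events" by auto
    show "decseq (\<lambda>n. no_arrival t (F n))"
      by (intro decseq_SucI) (auto simp: no_arrival_def F_def)
  qed
  moreover have "(\<Inter>n. no_arrival t (F n)) = no_arrival t P"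
    by (auto simp: no_arrival_def F_def) (metis lessI)
  moreover have "prob (no_arrival t (F n)) = exp (- (sum rate (F n) * t))" for n
    using F[of n] P t by (intro prob_no_arrival_finite) auto
  moreover have "(\<lambda>n. exp (- (sum rate (F n) * t))) \<longlonglongrightarrow> exp (- (infsum rate P * t))"
  proof (intro tendsto_exp tendsto_minus tendsto_mult tendsto_const)
    have "filterlim F (finite_subsets_at_top P) sequentially"
      unfolding filterlim_finite_subsets_at_top
    proof (intro allI impI)
      fix X assume X: "finite X \<and> X \<subseteq> P"
      then have "eventually (\<lambda>n. \<forall>p\<in>X. to_nat p < n) sequentially"
        by (intro eventually_ball_finite) (auto intro: eventually_gt_at_top)
      then show "eventually (\<lambda>n. finite (F n) \<and> X \<subseteq> F n \<and> F n \<subseteq> P) sequentially"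
      proof eventually_elim
        case (elim n)
        then show ?case using X F[of n] by (auto simp: F_def)
      qed
    qed
    with infsum_tendsto[OF summ] show "(\<lambda>n. sum rate (F n)) \<longlonglongrightarrow> infsum rate P"
      by (rule filterlim_compose)
  qed
  ultimately show ?thesis using LIMSEQ_unique by fastforce
qed

lemma
  assumes S: "S \<subseteq> all_edges" and t: "0 \<le> t"
  shows avoid_arrived_event: "{\<omega>\<in>space M. arrived_edges N t \<omega> \<inter> S = {}} \<in> events"
    and prob_avoid_arrived:
      "prob {\<omega>\<in>space M. arrived_edges N t \<omega> \<inter> S = {}} = exp (- (infsum (edge_weight \<mu>) S * t))"
proof -
  define P where "P = {p\<in>index_pairs. (case p of (i, j) \<Rightarrow> {i, j}) \<in> S}"
  have P: "P \<subseteq> index_pairs" by (auto simp: P_def)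
  have "(\<lambda>(i, j). {i, j}) ` P = S"
    using S by (force simp: P_def all_edges_def)
  then have bij: "bij_betw (\<lambda>(i, j). {i, j}) P S"
    using P bij_betw_subset[OF bij_betw_pairs_edges] by blast
  have rate_eq: "edge_weight \<mu> (case p of (i, j) \<Rightarrow> {i, j}) = rate p" if "p \<in> P" for p
    using that P by (auto simp: index_pairs_def edge_weight_doubleton)
  have "edge_weight \<mu> summable_on S"
    by (rule summable_on_subset_banach[OF edge_weight_summable[OF weights] S])
  then have "(\<lambda>p. edge_weight \<mu> (case p of (i, j) \<Rightarrow> {i, j})) summable_on P"
    using summable_on_reindex_bij_betw[OF bij, of "edge_weight \<mu>"] by blast
  then have summ: "rate summable_on P" by (rule summable_on_cong[THEN iffD1, rotated]) (rule rate_eq)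
  have "infsum rate P = (\<Sum>\<^sub>\<infinity>p\<in>P. edge_weight \<mu> (case p of (i, j) \<Rightarrow> {i, j}))"
    by (intro infsum_cong) (simp only: rate_eq)
  also have "\<dots> = infsum (edge_weight \<mu>) S" by (rule infsum_reindex_bij_betw[OF bij])
  finally have w: "infsum rate P = infsum (edge_weight \<mu>) S" .
  have eq: "{\<omega>\<in>space M. arrived_edges N t \<omega> \<inter> S = {}} = no_arrival t P"
  proof -
    have "arrived_edges N t \<omega> \<inter> S = {} \<longleftrightarrow> (\<forall>p\<in>P. \<not> 1 \<le> N (fst p) (snd p) t \<omega>)" for \<omega>
      unfolding arrived_edges_def P_def by (simp add: split_paired_all disjoint_iff) blast
    then show ?thesis by (simp add: no_arrival_def Suc_le_eq)
  qed
  show "{\<omega>\<in>space M. arrived_edges N t \<omega> \<inter> S = {}} \<in> events"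
    unfolding eq using P t by (rule no_arrival_event)
  show "prob {\<omega>\<in>space M. arrived_edges N t \<omega> \<inter> S = {}} = exp (- (infsum (edge_weight \<mu>) S * t))"
    unfolding eq w[symmetric] using P summ t by (rule prob_no_arrival)
qed

lemma AE_arrived_edges_mono:
  "AE \<omega> in M. \<forall>s t. 0 \<le> s \<longrightarrow> s \<le> t \<longrightarrow> arrived_edges N s \<omega> \<subseteq> arrived_edges N t \<omega>"
  using AE_paths
proof eventually_elim
  case (elim \<omega>)
  show ?case
  proof (intro allI impI subsetI)
    fix s t e assume st: "0 \<le> s" "s \<le> t" and "e \<in> arrived_edges N s \<omega>"
    then obtain i j where ij: "e = {i, j}" "(i, j) \<in> index_pairs" "1 \<le> N i j s \<omega>"
      by (auto simp: arrived_edges_def)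
    have "mono_on {0..} (\<lambda>t. N i j t \<omega>)" using elim ij by blast
    then have "N i j s \<omega> \<le> N i j t \<omega>" by (rule mono_onD) (use st in auto)
    then have "1 \<le> N i j t \<omega>" using ij by simp
    then show "e \<in> arrived_edges N t \<omega>" using ij unfolding arrived_edges_def by blast
  qed
qed

sublocale growing_edge_set M "edge_weight \<mu>" "\<lambda>x. exp (- x)" "\<lambda>n. arrived_edges N (real n)"
proof
  show "AE \<omega> in M. \<forall>n. arrived_edges N (real n) \<omega> \<subseteq> arrived_edges N (real (Suc n)) \<omega>"
    using AE_arrived_edges_mono by eventually_elim simp
  show "{\<omega>\<in>space M. arrived_edges N (real n) \<omega> \<inter> S = {}} \<in> events" if "S \<subseteq> all_edges" for S n
    using that by (intro avoid_arrived_event) auto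
  show "prob {\<omega>\<in>space M. arrived_edges N (real n) \<omega> \<inter> S = {}} = exp (- infsum (edge_weight \<mu>) S) ^ n"
    if "S \<subseteq> all_edges" for S n
    using prob_avoid_arrived[OF that, of "real n"]
    by (simp add: exp_of_nat_mult[symmetric] mult.commute)
  show "1 - x \<le> exp (- x)" for x :: real
    using exp_ge_add_one_self[of "- x"] by simp
  show "exp (- (x + y)) \<le> exp (- x) * exp (- y)" for x y :: real
    by (simp add: exp_add[symmetric])
  show "2 * exp (- (a + b - x)) \<le> exp (- a) * exp (- b) + exp (- (a + b - 2 * x))" for a b x :: real
  proof -
    \<comment> \<open>With these square roots the claim becomes \<open>2 * u * v \<le> u\<^sup>2 + v\<^sup>2\<close>.\<close>
    define u v where "u = exp (- (a + b) / 2)" and "v = exp (- (a + b) / 2 + x)"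
    have "exp (- (a + b - x)) = u * v" "exp (- a) * exp (- b) = u\<^sup>2" "exp (- (a + b - 2 * x)) = v\<^sup>2"
      by (simp_all add: u_def v_def power2_eq_square exp_add[symmetric])
    then show ?thesis using sum_squares_bound[of u v] by simp
  qed
  show "0 < infsum (edge_weight \<mu>) all_edges"
    using total_mass_pos[OF weights] infsum_edge_weight[OF weights] by simp
  show "arrived_edges N (real n) \<omega> \<subseteq> all_edges" for n \<omega>
    by (rule arrived_edges_subset)
qed (use edge_weight_nonneg[OF weights] edge_weight_summable[OF weights] in auto)

lemma mean_edges_eq:
  assumes t: "0 \<le> t"
  shows "mean_edges N t = expected_count (edge_weight \<mu>) all_edges t"
proof -
  let ?A = "\<lambda>e. {\<omega>\<in>space M. arrived_edges N t \<omega> \<inter> {e} \<noteq> {}}"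
  have A: "?A e = space M - {\<omega>\<in>space M. arrived_edges N t \<omega> \<inter> {e} = {}}" for e by auto
  have event: "?A e \<in> events" if "e \<in> all_edges" for e
    unfolding A using that t by (intro sets.compl_sets avoid_arrived_event) auto
  have prob: "prob (?A e) = 1 - exp (- edge_weight \<mu> e * t)" if "e \<in> all_edges" for e
    unfolding A using that t prob_avoid_arrived[of "{e}" t] avoid_arrived_event[of "{e}" t]
    by (simp add: prob_compl)
  have "mean_edges N t = expectation (\<lambda>\<omega>. real (card {e\<in>all_edges. \<omega> \<in> ?A e}))"
    unfolding mean_edges_def num_edges_def poisson_graph_eq
  proof (intro Bochner_Integration.integral_cong refl)
    fix \<omega> assume "\<omega> \<in> space M"
    then have "{e\<in>all_edges. \<omega> \<in> ?A e} = arrived_edges N t \<omega>"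
      using arrived_edges_subset[of N t \<omega>] by auto
    then show "real (card (snd (\<Union>(arrived_edges N t \<omega>), arrived_edges N t \<omega>))) =
      real (card {e\<in>all_edges. \<omega> \<in> ?A e})" by simp
  qed
  also have "\<dots> = (\<Sum>\<^sub>\<infinity>e\<in>all_edges. prob (?A e))"
  proof (intro expectation_card_occurring countable_all_edges event)
    have "(\<lambda>e. 1 - exp (- edge_weight \<mu> e * t)) summable_on all_edges"
      by (intro summable_one_minus_exp w_summable w_nonneg t)
    then show "(\<lambda>e. prob (?A e)) summable_on all_edges"
      by (rule summable_on_cong[THEN iffD1, rotated]) (rule prob[symmetric])
  qed
  also have "\<dots> = expected_count (edge_weight \<mu>) all_edges t"
    unfolding expected_count_def by (intro infsum_cong prob)
  finally show ?thesis .
qed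

lemma mean_vertices_eq:
  assumes t: "0 \<le> t"
  shows "mean_vertices N t = expected_count (vertex_rate \<mu>) {1..} t"
proof -
  let ?A = "\<lambda>i. {\<omega>\<in>space M. arrived_edges N t \<omega> \<inter> star i \<noteq> {}}"
  have A: "?A i = space M - {\<omega>\<in>space M. arrived_edges N t \<omega> \<inter> star i = {}}" for i by auto
  have event: "?A i \<in> events" for i
    unfolding A using t by (intro sets.compl_sets avoid_arrived_event star_subset)
  have prob: "prob (?A i) = 1 - exp (- vertex_rate \<mu> i * t)" if "i \<in> {1..}" for i
    unfolding A using that t prob_avoid_arrived[OF star_subset[of i], of t]
      avoid_arrived_event[OF star_subset[of i], of t] infsum_star[OF weights]
    by (simp add: prob_compl)
  have "mean_vertices N t = expectation (\<lambda>\<omega>. real (card {i\<in>{1..}. \<omega> \<in> ?A i}))"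
    unfolding mean_vertices_def num_vertices_def poisson_graph_eq
  proof (intro Bochner_Integration.integral_cong refl)
    fix \<omega> assume "\<omega> \<in> space M"
    then have "{i\<in>{1..}. \<omega> \<in> ?A i} = \<Union>(arrived_edges N t \<omega>)"
      using arrived_edges_subset[of N t \<omega>] by (fastforce simp: star_def elim: mem_all_edgesE)
    then show "real (card (fst (\<Union>(arrived_edges N t \<omega>), arrived_edges N t \<omega>))) =
      real (card {i\<in>{1..}. \<omega> \<in> ?A i})" by simp
  qed
  also have "\<dots> = (\<Sum>\<^sub>\<infinity>i\<in>{1..}. prob (?A i))"
  proof (intro expectation_card_occurring event)
    have "(\<lambda>i. 1 - exp (- vertex_rate \<mu> i * t)) summable_on {1..}"
      using vertex_rate_summable[OF weights] vertex_rate_nonneg[OF weights] t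
      by (intro summable_one_minus_exp) auto
    then show "(\<lambda>i. prob (?A i)) summable_on {1..}"
      by (rule summable_on_cong[THEN iffD1, rotated]) (rule prob[symmetric])
  qed simp
  also have "\<dots> = expected_count (vertex_rate \<mu>) {1..} t"
    unfolding expected_count_def by (intro infsum_cong prob)
  finally show ?thesis .
qed

text \<open>
  By monotonicity it is enough to have finitely many edges at all integer times.
\<close>
lemma AE_finite_arrived_edges: "AE \<omega> in M. \<forall>t\<ge>0. finite (arrived_edges N t \<omega>)"
  using edges.AE_finite_all AE_arrived_edges_mono AE_space
proof eventually_elim
  case (elim \<omega>)
  show ?case
  proof (intro allI impI)
    fix t :: real assume "0 \<le> t"
    obtain n :: nat where n: "t \<le> real n" using real_arch_simple by blast
    have "{e\<in>all_edges. \<omega> \<in> {\<omega>\<in>space M. arrived_edges N (real n) \<omega> \<inter> {e} \<noteq> {}}} = arrived_edges N (real n) \<omega>"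
      using arrived_edges_subset[of N "real n" \<omega>] elim(3) by auto
    then have "finite (arrived_edges N (real n) \<omega>)" using elim(1)[rule_format, of n] by (simp only:)
    then show "finite (arrived_edges N t \<omega>)" using elim(2) \<open>0 \<le> t\<close> n finite_subset by blast
  qed
qed

lemma AE_counts_mono:
  "AE \<omega> in M. mono_on {0..} (\<lambda>t. real (card (arrived_edges N t \<omega>))) \<and>
     mono_on {0..} (\<lambda>t. real (card (\<Union>(arrived_edges N t \<omega>))))"
  using AE_finite_arrived_edges AE_arrived_edges_mono
proof eventually_elim
  case (elim \<omega>)
  have "finite (\<Union>(arrived_edges N t \<omega>))" if "0 \<le> t" for t
    using elim(1) that arrived_edges_subset[of N t \<omega>] by (fastforce intro: finite_Union elim: mem_all_edgesE)
  moreover have "arrived_edges N s \<omega> \<subseteq> arrived_edges N t \<omega>" if "0 \<le> s" "s \<le> t" for s t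
    using elim(2) that by blast
  ultimately show ?case
    using elim(1) by (intro conjI mono_onI of_nat_mono card_mono Union_mono) simp_all
qed

end

section \<open>From integer to real time, and orders of growth\<close>

text \<open>
  If infinitely many rates are positive, the increment of the normalisation is bounded by \<open>R\<close> while
  its value tends to infinity; otherwise it converges to a positive limit. Time \<open>0\<close> is left out
  because the normalisation vanishes there.
\<close>
lemma expected_count_gap:
  fixes r :: "'i \<Rightarrow> real"
  assumes summ: "r summable_on I" and nonneg: "\<And>i. i \<in> I \<Longrightarrow> 0 \<le> r i" and j: "j \<in> I" "0 < r j"
  shows "(\<lambda>k. expected_count r I (real k + 2) / expected_count r I (real k + 1)) \<longlonglongrightarrow> 1"
proof -
  define a where "a t = expected_count r I t" for t
  have lim: "filterlim (\<lambda>k. real k + c) at_top sequentially" for c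
    by real_asymp
  show ?thesis
  proof (cases "finite {i\<in>I. 0 < r i}")
    case True
    let ?K = "card {i\<in>I. 0 < r i}"
    have "(\<lambda>k. a (real k + c)) \<longlonglongrightarrow> real ?K" for c
      unfolding a_def by (rule filterlim_compose[OF tendsto_expected_count lim]) (use nonneg True in auto)
    moreover have "?K \<noteq> 0" using True j by (simp only: card_eq_0_iff) blast
    ultimately have "(\<lambda>k. a (real k + 2) / a (real k + 1)) \<longlonglongrightarrow> real ?K / real ?K"
      by (intro tendsto_divide) auto
    then show ?thesis
      using \<open>?K \<noteq> 0\<close> unfolding a_def by (simp only: divide_self_if of_nat_eq_0_iff if_False)
  next
    case False
    define R where "R = infsum r I"
    have pos: "0 < a (real k + 1)" for k
      unfolding a_def by (rule expected_count_pos[OF summ nonneg _ j]) auto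
    have bounds: "a (real k + 1) \<le> a (real k + 2)" "a (real k + 2) \<le> a (real k + 1) + R" for k
      using expected_count_mono[OF summ nonneg, of "real k + 1" "real k + 2"]
        expected_count_step[OF summ nonneg, of "real k + 1"]
      by (simp_all add: a_def R_def add.commute)
    have "filterlim (\<lambda>k. a (real k + 1)) at_top sequentially"
      unfolding a_def by (rule filterlim_compose[OF filterlim_expected_count lim]) (use summ nonneg False in auto)
    then have "(\<lambda>k. R / a (real k + 1)) \<longlonglongrightarrow> 0"
      by (intro tendsto_divide_0[OF tendsto_const] filterlim_at_top_imp_at_infinity)
    then have upper: "(\<lambda>k. 1 + R / a (real k + 1)) \<longlonglongrightarrow> 1"
      using tendsto_add[OF tendsto_const[of "1::real"]] by fastforce
    have "(\<lambda>k. a (real k + 2) / a (real k + 1)) \<longlonglongrightarrow> 1"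
    proof (rule tendsto_sandwich[OF _ _ tendsto_const upper])
      show "eventually (\<lambda>k. 1 \<le> a (real k + 2) / a (real k + 1)) sequentially"
        using bounds(1) pos by simp
      show "eventually (\<lambda>k. a (real k + 2) / a (real k + 1) \<le> 1 + R / a (real k + 1)) sequentially"
      proof (intro always_eventually allI)
        fix k
        show "a (real k + 2) / a (real k + 1) \<le> 1 + R / a (real k + 1)"
          using bounds(2)[of k] pos[of k] by (simp add: divide_simps)
      qed
    qed
    then show ?thesis by (simp add: a_def)
  qed
qed

lemma ratio_tendsto_1_of_integer_times:
  fixes r :: "'i \<Rightarrow> real" and f :: "real \<Rightarrow> real"
  assumes summ: "r summable_on I" and nonneg: "\<And>i. i \<in> I \<Longrightarrow> 0 \<le> r i" and j: "j \<in> I" "0 < r j"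
    and f: "mono_on {0..} f" "\<And>t. 0 \<le> f t"
    and lim: "(\<lambda>n. f (real n) / expected_count r I (real n)) \<longlonglongrightarrow> 1"
  shows "((\<lambda>t. f t / expected_count r I t) \<longlongrightarrow> 1) at_top"
proof (rule ratio_tendsto_1_of_subsequence[where s = "\<lambda>k. real k + 1"])
  show "mono (\<lambda>k. real k + 1)" by (auto intro: monoI)
  show "filterlim (\<lambda>k. real k + 1) at_top sequentially" by real_asymp
  show "mono_on {real 0 + 1..} f" using f(1) by (rule mono_on_subset) auto
  show "mono_on {real 0 + 1..} (expected_count r I)"
    by (intro mono_onI expected_count_mono summ nonneg) auto
  show "0 < expected_count r I (real 0 + 1)"
    by (rule expected_count_pos[OF summ nonneg _ j]) auto
  show "(\<lambda>k. f (real k + 1) / expected_count r I (real k + 1)) \<longlonglongrightarrow> 1"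
    using LIMSEQ_Suc[OF lim] by (simp add: add.commute)
  show "(\<lambda>k. expected_count r I (real (Suc k) + 1) / expected_count r I (real k + 1)) \<longlonglongrightarrow> 1"
    using expected_count_gap[OF summ nonneg j] by (simp add: add.commute)
qed (rule f(2))

lemma filterlim_at_top_of_ratio:
  fixes f :: "'t \<Rightarrow> nat" and a :: "'t \<Rightarrow> real"
  assumes ratio: "((\<lambda>t. real (f t) / a t) \<longlongrightarrow> 1) F" and a: "filterlim a at_top F"
  shows "filterlim f at_top F"
proof -
  have "filterlim (\<lambda>t. real (f t) / a t * a t) at_top F"
    by (rule filterlim_tendsto_pos_mult_at_top[OF ratio _ a]) simp
  moreover have "eventually (\<lambda>t. real (f t) / a t * a t = real (f t)) F"
    using filterlim_at_top_dense[THEN iffD1, OF a, rule_format, of 0] by eventually_elim simp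
  ultimately have "filterlim (\<lambda>t. real (f t)) at_top F"
    by (rule filterlim_cong[THEN iffD1, OF refl refl, rotated])
  then show ?thesis by (simp add: filterlim_sequentially_iff_filterlim_real)
qed

text \<open>
  Changing the time scale by a constant factor changes the sum by at most a constant factor. This
  absorbs the factor between the number of draws and Poisson time.
\<close>
lemma infsum_min_dilate:
  fixes r :: "'i \<Rightarrow> real"
  assumes "r summable_on I" "\<And>i. i \<in> I \<Longrightarrow> 0 \<le> r i" "0 \<le> t" "0 < c"
  shows "(\<Sum>\<^sub>\<infinity>i\<in>I. min 1 (r i * (c * t))) \<le> max 1 c * (\<Sum>\<^sub>\<infinity>i\<in>I. min 1 (r i * t))"
proof -
  have summ: "(\<lambda>i. min 1 (r i * s)) summable_on I" if "0 \<le> s" for s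
    by (rule summable_on_comparison_test[OF summable_on_cmult_left[OF assms(1), of s]])
       (use assms that in auto)
  have "(\<Sum>\<^sub>\<infinity>i\<in>I. min 1 (r i * (c * t))) \<le> (\<Sum>\<^sub>\<infinity>i\<in>I. max 1 c * min 1 (r i * t))"
  proof (intro infsum_mono summ summable_on_cmult_right)
    fix i assume "i \<in> I"
    define x where "x = r i * t"
    have "0 \<le> x" using assms \<open>i \<in> I\<close> by (simp add: x_def)
    have "min 1 (c * x) \<le> max 1 c * min 1 x"
    proof (cases "x \<le> 1")
      case True
      have "c * x \<le> max 1 c * x" using \<open>0 \<le> x\<close> by (intro mult_right_mono) auto
      then show ?thesis using True by (simp add: min_def)
    qed auto
    then show "min 1 (r i * (c * t)) \<le> max 1 c * min 1 (r i * t)"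
      by (simp add: x_def mult.left_commute)
  qed (use assms in auto)
  also have "\<dots> = max 1 c * (\<Sum>\<^sub>\<infinity>i\<in>I. min 1 (r i * t))" by (rule infsum_cmult_right')
  finally show ?thesis .
qed

text \<open>
  Eventually \<open>f\<close> lies between half and twice the normalisation, which in turn is comparable with the
  sum of \<open>min 1 (r i * m)\<close>; the constants come from the factor \<open>1/2\<close> in the lower bound for
  \<open>1 - exp (- x)\<close> and from the change of time scale by \<open>c\<close>.
\<close>
lemma same_order_of_ratio:
  fixes f :: "nat \<Rightarrow> real" and r :: "'i \<Rightarrow> real"
  assumes summ: "r summable_on I" and nonneg: "\<And>i. i \<in> I \<Longrightarrow> 0 \<le> r i" and j: "j \<in> I" "0 < r j"
    and c: "0 < c" and lim: "(\<lambda>m. f m / expected_count r I (real m / c)) \<longlonglongrightarrow> 1"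
  shows "same_order f (\<lambda>m. \<Sum>\<^sub>\<infinity>i\<in>I. min 1 (r i * real m))"
proof -
  define a where "a m = expected_count r I (real m / c)" for m
  define h where "h t = (\<Sum>\<^sub>\<infinity>i\<in>I. min 1 (r i * t))" for t
  have h_nonneg: "0 \<le> h t" if "0 \<le> t" for t
    unfolding h_def using nonneg that by (intro infsum_nonneg) auto
  have lower: "h (real m) \<le> 2 * max 1 c * a m" for m
  proof -
    have "h (real m) \<le> max 1 c * h (real m / c)"
      using infsum_min_dilate[OF summ nonneg, of "real m / c" c] c by (simp add: h_def)
    also have "\<dots> \<le> max 1 c * (2 * a m)"
      using expected_count_bounds(1)[OF summ nonneg, of "real m / c"] c
      by (intro mult_left_mono) (auto simp: h_def a_def)
    finally show ?thesis by simp
  qed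
  have upper: "a m \<le> max 1 (1 / c) * h (real m)" for m
  proof -
    have "a m \<le> h (real m / c)"
      using expected_count_bounds(2)[OF summ nonneg, of "real m / c"] c by (simp add: h_def a_def)
    also have "\<dots> \<le> max 1 (1 / c) * h (real m)"
      using infsum_min_dilate[OF summ nonneg, of "real m" "1 / c"] c by (simp add: h_def)
    finally show ?thesis .
  qed
  have "eventually (\<lambda>m. 1 / 2 < f m / a m \<and> f m / a m < 2 \<and> 0 < a m) sequentially"
    using eventually_gt_at_top[of 0] order_tendstoD[OF lim, of "1/2"] order_tendstoD[OF lim, of 2]
    unfolding a_def
  proof (intro eventually_conj)
    show "eventually (\<lambda>m. 0 < expected_count r I (real m / c)) sequentially"
      using eventually_gt_at_top[of 0]
      by eventually_elim (rule expected_count_pos[OF summ nonneg _ j], use c in auto)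
  qed auto
  then obtain m0 where m0: "\<And>m. m \<ge> m0 \<Longrightarrow> 1 / 2 < f m / a m \<and> f m / a m < 2 \<and> 0 < a m"
    by (auto simp: eventually_sequentially)
  show ?thesis
    unfolding same_order_def h_def[symmetric]
  proof (intro exI conjI allI impI)
    fix m assume "m0 \<le> m"
    then have f: "a m / 2 \<le> f m" "f m \<le> 2 * a m" using m0[of m] by (auto simp: field_simps)
    have "1 / (4 * max 1 c) * h (real m) \<le> 1 / (4 * max 1 c) * (2 * max 1 c * a m)"
      by (intro mult_left_mono lower) auto
    also have "\<dots> = a m / 2" by (simp add: field_simps)
    finally show "1 / (4 * max 1 c) * h (real m) \<le> f m" using f by simp
    have "f m \<le> 2 * (max 1 (1 / c) * h (real m))" using f upper[of m] by simp
    then show "f m \<le> 2 * max 1 (1 / c) * h (real m)" by simp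
  qed auto
qed

lemma same_order_double: "same_order f g \<Longrightarrow> same_order f (\<lambda>m. 2 * g m)"
proof -
  assume "same_order f g"
  then obtain c C x0 where "c > 0" "C > 0" "\<And>x. x \<ge> x0 \<Longrightarrow> c * g x \<le> f x \<and> f x \<le> C * g x"
    by (auto simp: same_order_def)
  then show ?thesis
    unfolding same_order_def by (intro exI[of _ "c / 2"] conjI exI[of _ "C / 2"] exI[of _ x0]) auto
qed

lemma expected_count_time_scale: "expected_count (\<lambda>i. r i / c) I t = expected_count r I (t / c)"
  by (simp add: expected_count_def)

section \<open>Asymptotics of the two random graphs\<close>

theorem theorem6p4:
  fixes \<mu> :: "nat \<Rightarrow> nat \<Rightarrow> real"
    and M :: "'a measure" and Y :: "nat \<Rightarrow> 'a \<Rightarrow> nat set"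
    and M' :: "'b measure" and N :: "nat \<Rightarrow> nat \<Rightarrow> real \<Rightarrow> 'b \<Rightarrow> nat"
  defines "G \<equiv> edge_graph Y"
    and "Gt \<equiv> poisson_graph N"
    and "v \<equiv> prob_space.mean_vertices M' N"
    and "e \<equiv> prob_space.mean_edges M' N"
  assumes "edge_weights \<mu>"
    and "prob_space M" and "prob_space.iid_edges M \<mu> Y"
    and "prob_space M'" and "prob_space.poisson_arrivals M' \<mu> N"
  shows
    "(AE \<omega> in M'. ((\<lambda>t. real (num_vertices (Gt t \<omega>)) / v t) \<longlongrightarrow> 1) at_top) \<and>
     (AE \<omega> in M'. ((\<lambda>t. real (num_edges (Gt t \<omega>)) / e t) \<longlongrightarrow> 1) at_top) \<and>
     (infinite {(i, j). 1 \<le> i \<and> 1 \<le> j \<and> \<mu> i j > 0} \<longrightarrow>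
        filterlim v at_top at_top \<and>
        filterlim e at_top at_top \<and>
        (AE \<omega> in M'. filterlim (\<lambda>t. num_vertices (Gt t \<omega>)) at_top at_top) \<and>
        (AE \<omega> in M'. filterlim (\<lambda>t. num_edges (Gt t \<omega>)) at_top at_top)) \<and>
     (AE \<omega> in M. (\<lambda>m. real (num_vertices (G m \<omega>)) / v (real m / total_mass \<mu>)) \<longlonglongrightarrow> 1) \<and>
     (AE \<omega> in M. (\<lambda>m. real (num_edges (G m \<omega>)) / e (real m / total_mass \<mu>)) \<longlonglongrightarrow> 1) \<and>
     (AE \<omega> in M. same_order (\<lambda>m. real (num_vertices (G m \<omega>)))
        (\<lambda>m. \<Sum>\<^sub>\<infinity>i\<in>{1..}. min 1 (vertex_rate \<mu> i * real m))) \<and>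
     (AE \<omega> in M. same_order (\<lambda>m. real (num_edges (G m \<omega>)))
        (\<lambda>m. \<Sum>\<^sub>\<infinity>(i, j)\<in>{1..} \<times> {1..}. min 1 (\<mu> i j * real m))) \<and>
     (infinite {(i, j). 1 \<le> i \<and> 1 \<le> j \<and> \<mu> i j > 0} \<longrightarrow>
        (AE \<omega> in M. filterlim (\<lambda>m. num_vertices (G m \<omega>)) at_top sequentially) \<and>
        (AE \<omega> in M. filterlim (\<lambda>m. num_edges (G m \<omega>)) at_top sequentially))"
proof -
  note \<mu> = \<open>edge_weights \<mu>\<close>
  let ?W = "total_mass \<mu>"
  let ?w = "edge_weight \<mu>" and ?r = "vertex_rate \<mu>"
  have W: "0 < ?W" by (rule total_mass_pos[OF \<mu>])
  have w: "?w summable_on all_edges" "\<And>e. e \<in> all_edges \<Longrightarrow> 0 \<le> ?w e"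
    using edge_weight_summable[OF \<mu>] edge_weight_nonneg[OF \<mu>] by auto
  have r: "?r summable_on {1..}" "\<And>i. i \<in> {1..} \<Longrightarrow> 0 \<le> ?r i"
    using vertex_rate_summable[OF \<mu>] vertex_rate_nonneg[OF \<mu>] by auto

  interpret P: poisson_edges M' \<mu> N
    using assms by (simp add: poisson_edges_def poisson_edges_axioms_def)
  interpret Q: growing_edge_set M "\<lambda>e. ?w e / ?W" "\<lambda>x. 1 - x" "\<lambda>m \<omega>. (\<lambda>k. Y k \<omega>) ` {1..m}"
    using assms by (intro iid_growing_edge_set)

  obtain e0 where e0: "e0 \<in> all_edges" "0 < ?w e0" by (rule P.obtain_positive_edge)
  obtain i0 where i0: "i0 \<in> {1..}" "0 < ?r i0"
  proof -
    obtain i j where ij: "e0 = {i, j}" "1 \<le> i" "i < j" using e0(1) by (rule mem_all_edgesE)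
    then have "0 < \<mu> i j" using e0(2) by (simp add: edge_weight_doubleton)
    then show ?thesis using that[of i] vertex_rate_pos[OF \<mu>, of i j] ij by auto
  qed

  \<comment> \<open>From here on the means enter only through these formulas, which carry no trace of the space \<open>M'\<close> and so can be compared with the draws on \<open>M\<close>.\<close>
  have v: "v t = expected_count ?r {1..} t" if "0 \<le> t" for t
    unfolding v_def using that by (rule P.mean_vertices_eq)
  have e: "e t = expected_count ?w all_edges t" if "0 \<le> t" for t
    unfolding e_def using that by (rule P.mean_edges_eq)
  have v_m: "v (real m / ?W) = expected_count ?r {1..} (real m / ?W)"
    and e_m: "e (real m / ?W) = expected_count ?w all_edges (real m / ?W)" for m
    using W by (intro v e; simp)+
  have Gt: "num_vertices (Gt t \<omega>) = card (\<Union>(arrived_edges N t \<omega>))"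
    "num_edges (Gt t \<omega>) = card (arrived_edges N t \<omega>)" for t \<omega>
    by (simp_all add: Gt_def poisson_graph_eq num_vertices_def num_edges_def)
  have G: "num_vertices (G m \<omega>) = card (\<Union>((\<lambda>k. Y k \<omega>) ` {1..m}))"
    "num_edges (G m \<omega>) = card ((\<lambda>k. Y k \<omega>) ` {1..m})" for m \<omega>
    by (simp_all add: G_def edge_graph_def graph_of_edges_def num_vertices_def num_edges_def)
  have star_rates: "expected_count (\<lambda>i. infsum ?w (star i)) {1..} t = expected_count ?r {1..} t" for t
    unfolding expected_count_def using infsum_star[OF \<mu>] by (intro infsum_cong) auto
  have star_rates': "expected_count (\<lambda>i. infsum (\<lambda>e. ?w e / ?W) (star i)) {1..} t =
      expected_count ?r {1..} (t / ?W)" for t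
  proof -
    have "infsum (\<lambda>e. ?w e / ?W) (star i) = infsum ?w (star i) / ?W" for i
      unfolding divide_inverse by (rule infsum_cmult_left')
    then show ?thesis by (simp only: expected_count_time_scale star_rates)
  qed

  have Pv: "AE \<omega> in M'. ((\<lambda>t. real (num_vertices (Gt t \<omega>)) / v t) \<longlongrightarrow> 1) at_top"
    using P.AE_num_vertices_ratio P.AE_counts_mono
  proof eventually_elim
    case (elim \<omega>)
    have "((\<lambda>t. real (card (\<Union>(arrived_edges N t \<omega>))) / expected_count ?r {1..} t) \<longlongrightarrow> 1) at_top"
      using elim by (intro ratio_tendsto_1_of_integer_times[OF r i0]) (simp_all only: star_rates of_nat_0_le_iff)
    then show ?case
      by (rule Lim_transform_eventually)
         (use eventually_ge_at_top[of 0] in eventually_elim, simp add: v Gt)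
  qed
  have Pe: "AE \<omega> in M'. ((\<lambda>t. real (num_edges (Gt t \<omega>)) / e t) \<longlongrightarrow> 1) at_top"
    using P.AE_num_edges_ratio P.AE_counts_mono
  proof eventually_elim
    case (elim \<omega>)
    have "((\<lambda>t. real (card (arrived_edges N t \<omega>)) / expected_count ?w all_edges t) \<longlongrightarrow> 1) at_top"
      using elim by (intro ratio_tendsto_1_of_integer_times[OF w e0]) simp_all
    then show ?case
      by (rule Lim_transform_eventually)
         (use eventually_ge_at_top[of 0] in eventually_elim, simp add: e Gt)
  qed
  have Qv: "AE \<omega> in M. (\<lambda>m. real (num_vertices (G m \<omega>)) / v (real m / ?W)) \<longlonglongrightarrow> 1"
    using Q.AE_num_vertices_ratio by (simp only: star_rates' G v_m)
  have Qe: "AE \<omega> in M. (\<lambda>m. real (num_edges (G m \<omega>)) / e (real m / ?W)) \<longlonglongrightarrow> 1"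
    using Q.AE_num_edges_ratio by (simp only: expected_count_time_scale G e_m)

  have Ov: "AE \<omega> in M. same_order (\<lambda>m. real (num_vertices (G m \<omega>)))
      (\<lambda>m. \<Sum>\<^sub>\<infinity>i\<in>{1..}. min 1 (?r i * real m))"
    using Qv
  proof eventually_elim
    case (elim \<omega>)
    show ?case by (rule same_order_of_ratio[OF r i0 W elim[unfolded v_m]])
  qed
  have Oe: "AE \<omega> in M. same_order (\<lambda>m. real (num_edges (G m \<omega>)))
      (\<lambda>m. \<Sum>\<^sub>\<infinity>(i, j)\<in>{1..} \<times> {1..}. min 1 (\<mu> i j * real m))"
  proof -
    have pairs: "(\<Sum>\<^sub>\<infinity>(i, j)\<in>{1..} \<times> {1..}. min 1 (\<mu> i j * real m)) =
        2 * (\<Sum>\<^sub>\<infinity>e\<in>all_edges. min 1 (?w e * real m))" for m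
    proof (rule infsum_ordered_pairs[OF \<mu>])
      show "(\<lambda>e. min 1 (?w e * real m)) summable_on all_edges"
        by (rule summable_on_comparison_test[OF summable_on_cmult_left[OF w(1), of "real m"]])
           (use w(2) in auto)
    qed simp
    show ?thesis
      unfolding pairs using Qe
    proof eventually_elim
      case (elim \<omega>)
      show ?case by (rule same_order_double[OF same_order_of_ratio[OF w e0 W elim[unfolded e_m]]])
    qed
  qed

  have "filterlim v at_top at_top \<and> filterlim e at_top at_top \<and>
      (AE \<omega> in M'. filterlim (\<lambda>t. num_vertices (Gt t \<omega>)) at_top at_top) \<and>
      (AE \<omega> in M'. filterlim (\<lambda>t. num_edges (Gt t \<omega>)) at_top at_top) \<and>
      (AE \<omega> in M. filterlim (\<lambda>m. num_vertices (G m \<omega>)) at_top sequentially) \<and>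
      (AE \<omega> in M. filterlim (\<lambda>m. num_edges (G m \<omega>)) at_top sequentially)"
    if inf: "infinite {(i, j). 1 \<le> i \<and> 1 \<le> j \<and> \<mu> i j > 0}"
  proof -
    have "filterlim (expected_count ?r {1..}) at_top at_top"
      using infinite_positive_rates(1)[OF \<mu> inf] by (intro filterlim_expected_count r)
    then have v_top: "filterlim v at_top at_top"
      by (rule filterlim_cong[THEN iffD1, OF refl refl, rotated])
         (use eventually_ge_at_top[of 0] in eventually_elim, simp add: v)
    have "filterlim (expected_count ?w all_edges) at_top at_top"
      using infinite_positive_rates(2)[OF \<mu> inf] by (intro filterlim_expected_count w)
    then have e_top: "filterlim e at_top at_top"
      by (rule filterlim_cong[THEN iffD1, OF refl refl, rotated])
         (use eventually_ge_at_top[of 0] in eventually_elim, simp add: e)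
    have time: "filterlim (\<lambda>m. real m / ?W) at_top sequentially"
    proof -
      have "filterlim (\<lambda>m. inverse ?W * real m) at_top sequentially"
        by (rule filterlim_tendsto_pos_mult_at_top[OF tendsto_const _ filterlim_real_sequentially])
           (use W in simp)
      then show ?thesis by (simp add: divide_inverse mult.commute)
    qed
    have "AE \<omega> in M'. filterlim (\<lambda>t. num_vertices (Gt t \<omega>)) at_top at_top"
      using Pv by eventually_elim (rule filterlim_at_top_of_ratio[OF _ v_top])
    moreover have "AE \<omega> in M'. filterlim (\<lambda>t. num_edges (Gt t \<omega>)) at_top at_top"
      using Pe by eventually_elim (rule filterlim_at_top_of_ratio[OF _ e_top])
    moreover have "AE \<omega> in M. filterlim (\<lambda>m. num_vertices (G m \<omega>)) at_top sequentially"
      using Qv by eventually_elim (rule filterlim_at_top_of_ratio[OF _ filterlim_compose[OF v_top time]])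
    moreover have "AE \<omega> in M. filterlim (\<lambda>m. num_edges (G m \<omega>)) at_top sequentially"
      using Qe by eventually_elim (rule filterlim_at_top_of_ratio[OF _ filterlim_compose[OF e_top time]])
    ultimately show ?thesis using v_top e_top by blast
  qed
  then show ?thesis using Pv Pe Qv Qe Ov Oe by blast
qed

end
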